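(* Let $S$ be a preordered semiring with $1\ge 0$ and a power universal element $u$, and let $x,y\in S$ be nonzero. Then the following are equivalent: (a) $\phi(x)\le\phi(y)$ for all monotone semiring homomorphisms $\phi:S\to\mathbb{R}_+$, and for all monotone semiring homomorphisms $\phi:S\to\mathbb{TR}_+$ with $\phi(u)>1$. (b) For every real $\varepsilon>0$, we have $x^n\le u^{\lfloor\varepsilon n\rfloor}y^n$ for all sufficiently large $n\in\mathbb{N}$. Moreover, suppose that $\phi(x)<\phi(y)$ for all homomorphisms $\phi$ as in (a) (that is, all monotone homomorphisms $\phi:S\to\mathbb{R}_+$ and all monotone homomorphisms $\phi:S\to\mathbb{TR}_+$ with $\phi(u)>1$). Then also the following hold: (c) There is $k\in\mathbb{N}$ such that $u^kx^n\le u^ky^n$ for all sufficiently large $n\in\mathbb{N}$. (d) If $y$ is power universal as well, then $x^n\le y^n$ for all sufficiently large $n\in\mathbb{N}$. (e) There is nonzero $a\in S$ such that $ax\le ay$. Moreover, there is $k\in\mathbb{N}$ such that for every sufficiently large $n\in\mathbb{N}$, the choice $a:=u^k\sum_{j=0}^n x^jy^{n-j}$ satisfies $ax\le ay$.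
   Context: All structures are commutative. A semiring is a set with operations $+,\cdot$ and elements $0,1$ such that $(S,+,0)$ and $(S,\cdot,1)$ are commutative monoids, multiplication distributes over addition, and $0\cdot x=0$. A semiring homomorphism preserves $+,\cdot,0,1$. A preordered semiring is a semiring $S$ with a reflexive and transitive relation $\le$ such that $x\le y$ implies $a+x\le a+y$ and $ax\le ay$ for all $a,x,y\in S$. A map is monotone if $x\le y$ implies $f(x)\le f(y)$. A power universal element of $S$ is a nonzero $u\in S$ with $u\ge 1$ such that for all nonzero $x,y\in S$ with $x\le y$ there is $k\in\mathbb{N}$ with $y\le xu^k$. $\mathbb{R}_+$ is the semiring of nonnegative reals with the usual operations and order. $\mathbb{TR}_+$ is the tropical reals: the set of nonnegative reals with $\max$ as addition, the usual multiplication as multiplication (so its zero is $0$ and its unit is $1$), and the usual order. *)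

theory Defs
  imports Complex_Main
begin

text \<open>
  Semirings are types of class \<^class>\<open>comm_semiring_1\<close>. This class demands \<open>0 \<noteq> 1\<close>, which excludes
  only the one-element semiring; that one has no nonzero elements.
  The preorder is an explicit relation, since the order classes compatible with the algebraic
  structure are antisymmetric.
\<close>

locale preordered_semiring =
  fixes le :: "'a::comm_semiring_1 \<Rightarrow> 'a \<Rightarrow> bool"  (infix "\<preceq>" 50)
  assumes refl: "x \<preceq> x"
    and trans: "x \<preceq> y \<Longrightarrow> y \<preceq> z \<Longrightarrow> x \<preceq> z"
    and add_mono: "x \<preceq> y \<Longrightarrow> a + x \<preceq> a + y"
    and mult_mono: "x \<preceq> y \<Longrightarrow> a * x \<preceq> a * y"

definition power_universal :: "('a::comm_semiring_1 \<Rightarrow> 'a \<Rightarrow> bool) \<Rightarrow> 'a \<Rightarrow> bool" where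
  "power_universal le u \<longleftrightarrow> u \<noteq> 0 \<and> le 1 u \<and>
     (\<forall>x y. x \<noteq> 0 \<longrightarrow> y \<noteq> 0 \<longrightarrow> le x y \<longrightarrow> (\<exists>k::nat. le y (x * u ^ k)))"

definition semiring_hom :: "('a::comm_semiring_1 \<Rightarrow> 'b::comm_semiring_1) \<Rightarrow> bool" where
  "semiring_hom f \<longleftrightarrow> f 0 = 0 \<and> f 1 = 1 \<and>
     (\<forall>x y. f (x + y) = f x + f y) \<and> (\<forall>x y. f (x * y) = f x * f y)"

definition monotone_semiring_hom ::
  "('a::comm_semiring_1 \<Rightarrow> 'a \<Rightarrow> bool) \<Rightarrow> ('a \<Rightarrow> 'b::{comm_semiring_1, ord}) \<Rightarrow> bool" where
  "monotone_semiring_hom le f \<longleftrightarrow> semiring_hom f \<and> monotone le (\<le>) f"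


text \<open>The semiring $\mathbb{R}_+$.\<close>

typedef nnreal = "{r::real. 0 \<le> r}"
  morphisms real_of_nnreal Abs_nnreal
  by auto

setup_lifting type_definition_nnreal

instantiation nnreal :: "{comm_semiring_1, linorder}"
begin

lift_definition zero_nnreal :: nnreal is "0::real" by simp
lift_definition one_nnreal :: nnreal is "1::real" by simp
lift_definition plus_nnreal :: "nnreal \<Rightarrow> nnreal \<Rightarrow> nnreal" is "\<lambda>a b::real. a + b" by simp
lift_definition times_nnreal :: "nnreal \<Rightarrow> nnreal \<Rightarrow> nnreal" is "\<lambda>a b::real. a * b" by simp
lift_definition less_eq_nnreal :: "nnreal \<Rightarrow> nnreal \<Rightarrow> bool" is "\<lambda>a b::real. a \<le> b" .
lift_definition less_nnreal :: "nnreal \<Rightarrow> nnreal \<Rightarrow> bool" is "\<lambda>a b::real. a < b" .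

instance
  by standard (transfer, force simp: algebra_simps)+

end


text \<open>
  The tropical reals $\mathbb{TR}_+$, in multiplicative notation: addition is \<open>max\<close>,
  multiplication is the usual one.
\<close>

typedef tropical = "{r::real. 0 \<le> r}"
  morphisms real_of_tropical Abs_tropical
  by auto

setup_lifting type_definition_tropical

instantiation tropical :: "{comm_semiring_1, linorder}"
begin

lift_definition zero_tropical :: tropical is "0::real" by simp
lift_definition one_tropical :: tropical is "1::real" by simp
lift_definition plus_tropical :: "tropical \<Rightarrow> tropical \<Rightarrow> tropical" is "\<lambda>a b::real. max a b" by simp
lift_definition times_tropical :: "tropical \<Rightarrow> tropical \<Rightarrow> tropical" is "\<lambda>a b::real. a * b" by simp
lift_definition less_eq_tropical :: "tropical \<Rightarrow> tropical \<Rightarrow> bool" is "\<lambda>a b::real. a \<le> b" .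
lift_definition less_tropical :: "tropical \<Rightarrow> tropical \<Rightarrow> bool" is "\<lambda>a b::real. a < b" .

instance
proof
  fix a b c :: tropical
  show "a + b + c = a + (b + c)" by transfer (simp add: max.assoc)
  show "a + b = b + a" by transfer (simp add: max.commute)
  show "0 + a = a" by transfer simp
  show "a * b * c = a * (b * c)" by transfer simp
  show "a * b = b * a" by transfer simp
  show "1 * a = a" by transfer simp
  show "(a + b) * c = a * c + b * c" by transfer (simp add: max_mult_distrib_right)
  show "0 * a = 0" by transfer simp
  show "a * 0 = 0" by transfer simp
  show "(0::tropical) \<noteq> 1" by transfer simp
  show "a < b \<longleftrightarrow> a \<le> b \<and> \<not> b \<le> a" by transfer auto
  show "a \<le> a" by transfer simp
  show "a \<le> b \<Longrightarrow> b \<le> c \<Longrightarrow> a \<le> c" by transfer simp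
  show "a \<le> b \<Longrightarrow> b \<le> a \<Longrightarrow> a = b" by transfer simp
  show "a \<le> b \<or> b \<le> a" by transfer auto
qed

end

end

theory Submission
  imports Defs
begin

text \<open>
  If \<open>1 \<preceq> 0\<close>, then any two elements are comparable in both directions, there are no monotone
  homomorphisms, and every claim is trivial. Otherwise a power of \<open>u\<close> bounds every nonzero element
  from above and from below, so that there are no zero divisors, and \<open>c * x \<preceq> c * y\<close> with \<open>c \<noteq> 0\<close>
  can be traded for \<open>x\<^sup>n \<preceq> u\<^sup>K y\<^sup>n\<close>, with \<open>K\<close> independent of \<open>n\<close>.

  The core is that strict inequality under all homomorphisms forces \<open>c * x \<preceq> c * y\<close> for some
  \<open>c \<noteq> 0\<close> (\<open>strict_imp_catalytic\<close>). Suppose that there is no such \<open>c\<close>. Among the multiplicatively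
  cancellative preorders which extend \<open>\<preceq>\<close> and do not put \<open>x\<close> below \<open>y\<close>, take a maximal one. It is
  total: if \<open>a\<close> and \<open>b\<close> were incomparable, then adjoining \<open>a \<le> b\<close> would put \<open>x\<close> below \<open>y\<close>, and so
  would adjoining \<open>b \<le> a\<close>; but an inequality that follows from both adjunctions already holds
  (\<open>adjoin_both_directions\<close>). Since \<open>x\<close> stays strictly above \<open>y\<close>, not everything nonzero collapses,
  so \<open>u\<close> stays strictly above \<open>1\<close>. If now some natural number dominates \<open>u\<close>, then comparison
  with the rationals gives a monotone homomorphism to the nonnegative reals. If not, then sums are
  negligible against \<open>u\<close>, and the logarithm to base \<open>u\<close> gives a homomorphism to the tropical reals
  with \<open>\<phi> u = 2\<close>. Both are instances of one embedding of archimedean monoids into the reals, as in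
  Hoelder's theorem. Totality gives \<open>\<phi> y \<le> \<phi> x\<close>, against strictness.

  For (a) \<open>\<Longrightarrow>\<close> (b) the core result is applied to \<open>x\<^sup>m\<close> and \<open>u * y\<^sup>m\<close>: the hypothesis
  \<open>\<phi> x \<le> \<phi> y\<close> yields a strict inequality between these, as \<open>\<phi> u > 1\<close> and \<open>\<phi> y > 0\<close>. The
  converse takes \<open>n\<close>-th roots.

  For (c) and (d) the inequality between \<open>x\<close> and \<open>y\<close> needs some room, and a compactness
  argument provides it: some \<open>m \<ge> 1\<close> satisfies \<open>c * (u * x\<^sup>m) \<preceq> c * y\<^sup>m\<close>
  (\<open>strict_imp_uniform_gap\<close>). The factors of \<open>u\<close> gained by taking powers of this absorb every
  constant. The sum in (e) turns (c) into the claim by telescoping.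
\<close>

section \<open>Two facts about real numbers\<close>

lemma eq_if_close:
  fixes a b c :: real
  assumes "\<And>n::nat. n > 0 \<Longrightarrow> \<bar>a - b\<bar> \<le> c / real n"
  shows "a = b"
proof (rule ccontr)
  assume "a \<noteq> b"
  then obtain n :: nat where n: "c < real n * \<bar>a - b\<bar>"
    using reals_Archimedean3[of "\<bar>a - b\<bar>"] by auto
  have "\<bar>a - b\<bar> \<le> c / real (Suc n)"
    by (rule assms) simp
  then show False
    using n abs_ge_zero[of "a - b"] by (simp add: field_simps)
qed

lemma le_if_powers_le:
  fixes a b c :: real
  assumes "0 \<le> b" and le: "\<And>m::nat. m \<ge> 1 \<Longrightarrow> a ^ m \<le> c * b ^ m"
  shows "a \<le> b"
proof (rule ccontr)
  assume ab: "\<not> a \<le> b"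
  show False
  proof (cases "b = 0")
    case True
    then show False
      using le[of 1] ab by simp
  next
    case False
    then have b: "b > 0"
      using assms(1) by simp
    then have "a / b > 1"
      using ab by simp
    then obtain n where n: "max c 1 < (a / b) ^ n"
      using real_arch_pow by blast
    then have "n \<noteq> 0"
      by (cases n) auto
    then have "a ^ n \<le> c * b ^ n"
      using le by simp
    then have "(a / b) ^ n \<le> c"
      using b by (simp add: power_divide field_simps)
    then show False
      using n by simp
  qed
qed

section \<open>Totally preordered archimedean monoids\<close>

text \<open>
  Integer powers of the unit \<open>e\<close> bound every element from both sides. Summands need
  not cancel in a totally preordered semiring, so \<open>pow_unit_leq_imp\<close> takes the place of cancellation.
  The carrier \<open>A\<close> allows for the multiplicative monoid of nonzero elements, and \<open>pow\<close> is a
  parameter so that it can be either \<open>of_nat n * z\<close> or \<open>z ^ n\<close>.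
\<close>
locale archimedean_preordered_monoid = comm_monoid mul one
  for mul :: "'b \<Rightarrow> 'b \<Rightarrow> 'b" (infixl "\<star>" 70) and one :: 'b ("\<iota>") +
  fixes A :: "'b set" and pow :: "nat \<Rightarrow> 'b \<Rightarrow> 'b" and leq :: "'b \<Rightarrow> 'b \<Rightarrow> bool" (infix "\<preceq>" 50)
    and e :: 'b
  assumes one_closed: "\<iota> \<in> A"
    and mul_closed: "x \<in> A \<Longrightarrow> y \<in> A \<Longrightarrow> x \<star> y \<in> A"
    and unit_closed: "e \<in> A"
    and pow_0: "pow 0 x = \<iota>"
    and pow_Suc: "pow (Suc n) x = x \<star> pow n x"
    and leq_total: "x \<in> A \<Longrightarrow> y \<in> A \<Longrightarrow> x \<preceq> y \<or> y \<preceq> x"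
    and leq_trans: "x \<preceq> y \<Longrightarrow> y \<preceq> z \<Longrightarrow> x \<preceq> z"
    and mul_leq_mono: "x \<preceq> y \<Longrightarrow> a \<star> x \<preceq> a \<star> y"
    and one_leq_unit: "\<iota> \<preceq> e"
    and pow_unit_leq_imp: "pow m e \<preceq> pow n e \<Longrightarrow> m \<le> n"
    and bounded_above: "x \<in> A \<Longrightarrow> \<exists>k. x \<preceq> pow k e"
    and bounded_below: "x \<in> A \<Longrightarrow> \<exists>k. \<iota> \<preceq> x \<star> pow k e"
begin

lemma pow_closed: "x \<in> A \<Longrightarrow> pow n x \<in> A"
  by (induction n) (auto simp: pow_0 pow_Suc one_closed mul_closed)

lemma pow_add: "pow (m + n) x = pow m x \<star> pow n x"
  by (induction m) (auto simp: pow_0 pow_Suc assoc)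

lemma pow_mul: "pow n (x \<star> y) = pow n x \<star> pow n y"
  by (induction n) (auto simp: pow_0 pow_Suc ac_simps)

lemma pow_mult: "pow (m * n) x = pow m (pow n x)"
  by (induction m) (auto simp: pow_0 pow_Suc pow_add)

lemma mul_leq_mono2: "x \<preceq> y \<Longrightarrow> x' \<preceq> y' \<Longrightarrow> x \<star> x' \<preceq> y \<star> y'"
  by (metis commute leq_trans mul_leq_mono)

lemma leq_refl: "x \<in> A \<Longrightarrow> x \<preceq> x"
  using leq_total by blast

lemma pow_mono: "x \<in> A \<Longrightarrow> x \<preceq> y \<Longrightarrow> pow n x \<preceq> pow n y"
  by (induction n) (auto simp: pow_0 pow_Suc mul_leq_mono2 leq_refl one_closed)

text \<open>
  In additive notation, the rationals \<open>r\<close> with \<open>r * e \<preceq> x\<close>. Putting \<open>k\<close> copies of \<open>e\<close> on the right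
  expresses negative \<open>r\<close> without inverses.
\<close>
definition below :: "'b \<Rightarrow> real set" where
  "below x = {(real p - real k) / real q | p k q. q > 0 \<and> pow p e \<preceq> pow q x \<star> pow k e}"

definition height :: "'b \<Rightarrow> real" where
  "height x = Sup (below x)"

text \<open>
  The two comparisons are scaled to the common denominator \<open>q * q'\<close> and composed, which leaves a
  comparison of two powers of \<open>e\<close>. Shifts are added on both sides instead of being cancelled.
\<close>
lemma below_le_above:
  assumes "x \<in> A" "r \<in> below x" and up: "pow q x \<star> pow k e \<preceq> pow p e" and q: "q > 0"
  shows "r \<le> (real p - real k) / real q"
proof -
  obtain p' k' q' where r: "r = (real p' - real k') / real q'" and q': "q' > 0"
    and lo: "pow p' e \<preceq> pow q' x \<star> pow k' e"
    using assms(2) by (auto simp: below_def)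
  have "pow q (pow p' e) \<preceq> pow q (pow q' x \<star> pow k' e)"
    by (intro pow_mono lo pow_closed unit_closed)
  then have "pow (q' * k) e \<star> pow q (pow p' e) \<preceq> pow (q' * k) e \<star> pow q (pow q' x \<star> pow k' e)"
    by (rule mul_leq_mono)
  also have "pow (q' * k) e \<star> pow q (pow p' e) = pow (q * p' + q' * k) e"
    unfolding pow_add pow_mult by (rule commute)
  also have "pow (q' * k) e \<star> pow q (pow q' x \<star> pow k' e)
      = pow q' (pow q x \<star> pow k e) \<star> pow (q * k') e"
    by (simp add: pow_mul ac_simps flip: pow_mult)
  finally have "pow (q * p' + q' * k) e \<preceq> pow q' (pow q x \<star> pow k e) \<star> pow (q * k') e" .
  moreover have "pow q' (pow q x \<star> pow k e) \<preceq> pow q' (pow p e)"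
    by (intro pow_mono up pow_closed mul_closed unit_closed assms(1))
  then have "pow (q * k') e \<star> pow q' (pow q x \<star> pow k e) \<preceq> pow (q * k') e \<star> pow q' (pow p e)"
    by (rule mul_leq_mono)
  then have "pow q' (pow q x \<star> pow k e) \<star> pow (q * k') e \<preceq> pow (q' * p + q * k') e"
    unfolding pow_add pow_mult by (simp only: commute)
  ultimately have "pow (q * p' + q' * k) e \<preceq> pow (q' * p + q * k') e"
    by (rule leq_trans)
  then have "q * p' + q' * k \<le> q' * p + q * k'"
    by (rule pow_unit_leq_imp)
  then have "real (q * p' + q' * k) \<le> real (q' * p + q * k')"
    by (simp only: of_nat_le_iff)
  then show ?thesis
    using q q' by (simp add: r field_simps)
qed

text \<open>
  After a shift by \<open>pow k e\<close>, totality turns the least power of \<open>e\<close> above \<open>pow n x\<close> into two bounds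
  that differ by one factor \<open>e\<close>. They determine \<open>height x\<close> up to \<open>1 / n\<close>.
\<close>
lemma approximation:
  assumes "x \<in> A"
  obtains a k where "pow a e \<preceq> pow n x \<star> pow k e" "pow n x \<star> pow k e \<preceq> pow (Suc a) e"
proof -
  obtain k where k: "\<iota> \<preceq> x \<star> pow k e"
    using bounded_below assms by blast
  let ?y = "pow n x \<star> pow (n * k) e"
  have y: "?y \<in> A"
    by (intro mul_closed pow_closed assms unit_closed)
  have "pow n \<iota> \<preceq> pow n (x \<star> pow k e)"
    by (intro pow_mono k one_closed)
  moreover have "pow n \<iota> = \<iota>"
    by (induction n) (auto simp: pow_0 pow_Suc)
  ultimately have pos: "\<iota> \<preceq> ?y"
    by (simp add: pow_mul pow_mult)
  obtain m where m: "?y \<preceq> pow m e"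
    using bounded_above y by blast
  define p where "p = (LEAST p. ?y \<preceq> pow p e)"
  have p: "?y \<preceq> pow p e"
    unfolding p_def using m by (rule LeastI)
  show ?thesis
  proof (cases p)
    case 0
    have "?y \<preceq> pow (Suc 0) e"
      using p 0 one_leq_unit leq_trans by (auto simp: pow_Suc pow_0)
    then show ?thesis
      using that[of 0 "n * k"] pos by (simp add: pow_0)
  next
    case (Suc a)
    then have "\<not> ?y \<preceq> pow a e"
      unfolding p_def by (metis lessI not_less_Least)
    then have "pow a e \<preceq> ?y"
      using leq_total y pow_closed unit_closed by blast
    then show ?thesis
      using that[of a "n * k"] p Suc by simp
  qed
qed

lemma below_nonempty: "x \<in> A \<Longrightarrow> below x \<noteq> {}"
proof -
  assume "x \<in> A"
  then obtain a k where "pow a e \<preceq> pow (Suc 0) x \<star> pow k e"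
    using approximation by blast
  then show ?thesis
    unfolding below_def by blast
qed

lemma height_le:
  assumes "x \<in> A" "pow q x \<star> pow k e \<preceq> pow p e" "q > 0"
  shows "height x \<le> (real p - real k) / real q"
  unfolding height_def using below_nonempty below_le_above assms by (blast intro: cSup_least)

lemma le_height:
  assumes "x \<in> A" "pow p e \<preceq> pow q x \<star> pow k e" "q > 0"
  shows "(real p - real k) / real q \<le> height x"
  unfolding height_def
proof (rule cSup_upper)
  show "(real p - real k) / real q \<in> below x"
    unfolding below_def using assms by blast
  obtain a k where "pow (Suc 0) x \<star> pow k e \<preceq> pow (Suc a) e"
    using approximation[OF assms(1)] by blast
  then show "bdd_above (below x)"
    using below_le_above[OF assms(1)] by (meson bdd_aboveI zero_less_Suc)
qed

lemma height_mul:
  assumes x: "x \<in> A" and y: "y \<in> A"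
  shows "height (x \<star> y) = height x + height y"
proof (rule eq_if_close)
  fix n :: nat
  assume n: "n > 0"
  obtain a k where ak: "pow a e \<preceq> pow n x \<star> pow k e" "pow n x \<star> pow k e \<preceq> pow (Suc a) e"
    using approximation x by blast
  obtain b l where bl: "pow b e \<preceq> pow n y \<star> pow l e" "pow n y \<star> pow l e \<preceq> pow (Suc b) e"
    using approximation y by blast
  have "pow (a + b) e \<preceq> pow n (x \<star> y) \<star> pow (k + l) e"
    using mul_leq_mono2[OF ak(1) bl(1)] by (simp add: pow_add pow_mul ac_simps)
  moreover have "pow n (x \<star> y) \<star> pow (k + l) e \<preceq> pow (Suc a + Suc b) e"
    using mul_leq_mono2[OF ak(2) bl(2)] by (simp only: pow_add pow_mul ac_simps)
  ultimately have "(real (a + b) - real (k + l)) / n \<le> height (x \<star> y)"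
    "height (x \<star> y) \<le> (real (Suc a + Suc b) - real (k + l)) / n"
    using le_height height_le mul_closed[OF x y] n by blast+
  moreover have "(real a - real k) / n \<le> height x" "height x \<le> (real (Suc a) - real k) / n"
    using le_height height_le ak x n by blast+
  moreover have "(real b - real l) / n \<le> height y" "height y \<le> (real (Suc b) - real l) / n"
    using le_height height_le bl y n by blast+
  ultimately show "\<bar>height (x \<star> y) - (height x + height y)\<bar> \<le> 2 / real n"
    using n by (simp add: field_simps abs_le_iff)
qed

lemma additive_pow:
  fixes g :: "'b \<Rightarrow> real"
  assumes add: "\<And>x y. x \<in> A \<Longrightarrow> y \<in> A \<Longrightarrow> g (x \<star> y) = g x + g y" and x: "x \<in> A"
  shows "g (pow n x) = real n * g x"
proof (induction n)
  case 0
  show ?case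
    using add[OF one_closed one_closed] by (simp add: pow_0)
next
  case (Suc n)
  then show ?case
    by (simp add: pow_Suc add x pow_closed algebra_simps)
qed

text \<open>
  Monotonicity traps \<open>g x\<close> between the images of the same bounds that determine \<open>height x\<close>. Applied
  below to \<open>z \<mapsto> height (w * z)\<close>, this makes the height for the additive monoid of a semiring
  multiplicative.
\<close>
lemma additive_mono_unique:
  fixes g :: "'b \<Rightarrow> real"
  assumes add: "\<And>x y. x \<in> A \<Longrightarrow> y \<in> A \<Longrightarrow> g (x \<star> y) = g x + g y"
    and mono: "\<And>x y. x \<in> A \<Longrightarrow> y \<in> A \<Longrightarrow> x \<preceq> y \<Longrightarrow> g x \<le> g y"
    and x: "x \<in> A"
  shows "g x = g e * height x"
proof (rule eq_if_close)
  fix n :: nat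
  assume n: "n > 0"
  obtain a k where ak: "pow a e \<preceq> pow n x \<star> pow k e" "pow n x \<star> pow k e \<preceq> pow (Suc a) e"
    using approximation x by blast
  have closed: "pow n x \<star> pow k e \<in> A" "pow m e \<in> A" for m
    by (intro mul_closed pow_closed x unit_closed)+
  have g_pow: "g (pow n x \<star> pow k e) = real n * g x + real k * g e" "g (pow m e) = real m * g e" for m
    by (simp_all add: add additive_pow[of g] pow_closed x unit_closed)
  have "(real a - real k) * g e \<le> real n * g x" "real n * g x \<le> (real (Suc a) - real k) * g e"
    using mono[OF closed(2) closed(1) ak(1)] mono[OF closed(1) closed(2) ak(2)]
    unfolding g_pow by (simp_all only: left_diff_distrib)
  then have gx: "(real a - real k) * g e / n \<le> g x" "g x \<le> (real (Suc a) - real k) * g e / n"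
    using n by (simp_all add: field_simps)
  have "0 \<le> g e"
    using mono[OF one_closed unit_closed one_leq_unit] additive_pow[of g e 0, OF add unit_closed]
    by (simp add: pow_0)
  moreover have "(real a - real k) / n \<le> height x" "height x \<le> (real (Suc a) - real k) / n"
    using le_height height_le ak x n by blast+
  ultimately have "g e * ((real a - real k) / n) \<le> g e * height x"
    "g e * height x \<le> g e * ((real (Suc a) - real k) / n)"
    by (simp_all only: mult_left_mono)
  with gx show "\<bar>g x - g e * height x\<bar> \<le> g e / n"
    using n by (simp add: abs_le_iff field_simps)
qed

lemma height_mono:
  assumes x: "x \<in> A" and y: "y \<in> A" and "x \<preceq> y"
  shows "height x \<le> height y"
  unfolding height_def
proof (rule cSup_least)
  show "below x \<noteq> {}"
    using below_nonempty x .
  fix r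
  assume "r \<in> below x"
  then obtain p k q where r: "r = (real p - real k) / real q" and q: "q > 0"
    and lo: "pow p e \<preceq> pow q x \<star> pow k e"
    by (auto simp: below_def)
  have "pow q x \<star> pow k e \<preceq> pow q y \<star> pow k e"
    using pow_mono[OF x \<open>x \<preceq> y\<close>] mul_leq_mono2 leq_refl pow_closed unit_closed by blast
  then show "r \<le> Sup (below y)"
    using le_height[OF y] lo q leq_trans unfolding r height_def by blast
qed

lemma height_unit: "height e = 1"
proof -
  have "pow (Suc 0) e \<preceq> pow (Suc 0) e \<star> pow 0 e" "pow (Suc 0) e \<star> pow 0 e \<preceq> pow (Suc 0) e"
    by (simp_all add: pow_0 pow_Suc leq_refl unit_closed)
  then show ?thesis
    using le_height[OF unit_closed, of "Suc 0" "Suc 0" 0] height_le[OF unit_closed, of "Suc 0" 0 "Suc 0"]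
    by simp
qed

end

section \<open>Semirings whose nonzero elements are bounded by powers of u\<close>

locale bounded_preordered_semiring = preordered_semiring le
  for le :: "'a::comm_semiring_1 \<Rightarrow> 'a \<Rightarrow> bool" (infix "\<preceq>" 50) +
  fixes u :: 'a
  assumes zero_le_one: "0 \<preceq> 1"
    and not_one_le_zero: "\<not> 1 \<preceq> 0"
    and power_universal: "power_universal (\<preceq>) u"
begin

lemma zero_le: "0 \<preceq> z"
  using mult_mono[OF zero_le_one, of z] by simp

lemma one_le_u: "1 \<preceq> u"
  using power_universal by (simp add: power_universal_def)

lemma le_add_left: "z \<preceq> w + z"
  using add_mono[OF zero_le, of z w] by (simp add: add.commute)

lemma mult_mono2: "a \<preceq> b \<Longrightarrow> c \<preceq> d \<Longrightarrow> a * c \<preceq> b * d"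
  by (metis mult.commute mult_mono trans)

lemma sum_nonzero:
  fixes z w :: 'a
  shows "w \<noteq> 0 \<Longrightarrow> z + w \<noteq> 0"
proof
  assume w: "w \<noteq> 0" and "z + w = 0"
  then have "w \<preceq> 0"
    using le_add_left[of w z] by simp
  have "1 + w \<noteq> 0"
    using le_add_left[of 1 w] not_one_le_zero by (auto simp: add.commute)
  then obtain k where "1 + w \<preceq> w * u ^ k"
    using power_universal w le_add_left[of w 1] unfolding power_universal_def by blast
  moreover have "w * u ^ k \<preceq> 0"
    using mult_mono[OF \<open>w \<preceq> 0\<close>, of "u ^ k"] by (simp add: mult.commute)
  moreover have "1 \<preceq> 1 + w"
    using le_add_left[of 1 w] by (simp add: add.commute)
  ultimately show False
    using not_one_le_zero trans by blast
qed

lemma le_u_power: "\<exists>k. z \<preceq> u ^ k"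
proof -
  obtain k where "z + 1 \<preceq> 1 * u ^ k"
    using power_universal le_add_left[of 1 z] sum_nonzero[of 1 z]
    unfolding power_universal_def by (metis one_neq_zero)
  then show ?thesis
    using le_add_left[of z 1] by (metis add.commute mult_1 trans)
qed

lemma one_le_mult_u_power: "z \<noteq> 0 \<Longrightarrow> \<exists>k. 1 \<preceq> z * u ^ k"
proof -
  assume z: "z \<noteq> 0"
  then obtain k where "1 + z \<preceq> z * u ^ k"
    using power_universal le_add_left[of z 1] sum_nonzero[of z 1]
    unfolding power_universal_def by blast
  then show ?thesis
    using le_add_left[of 1 z] by (metis add.commute trans)
qed

lemma mult_nonzero:
  fixes z w :: 'a
  shows "z \<noteq> 0 \<Longrightarrow> w \<noteq> 0 \<Longrightarrow> z * w \<noteq> 0"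
proof
  assume zw: "z \<noteq> 0" "w \<noteq> 0" "z * w = 0"
  obtain k l where "1 \<preceq> z * u ^ k" "1 \<preceq> w * u ^ l"
    using one_le_mult_u_power zw by blast
  then have "1 * 1 \<preceq> z * u ^ k * (w * u ^ l)"
    by (rule mult_mono2)
  moreover have "z * u ^ k * (w * u ^ l) = z * w * (u ^ k * u ^ l)"
    by (simp add: ac_simps)
  ultimately show False
    using zw not_one_le_zero by simp
qed

lemma power_nonzero:
  fixes z w :: 'a
  shows "z \<noteq> 0 \<Longrightarrow> z ^ n \<noteq> 0"
  by (induction n) (auto simp: mult_nonzero)

lemma power_mono2: "a \<preceq> b \<Longrightarrow> a ^ n \<preceq> b ^ n"
  by (induction n) (auto simp: mult_mono2 refl)

lemma one_le_u_power: "1 \<preceq> u ^ k"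
  using power_mono2[OF one_le_u, of k] by simp

lemma u_power_mono: "k \<le> l \<Longrightarrow> u ^ k \<preceq> u ^ l"
  using mult_mono[OF one_le_u_power, of "u ^ k" "l - k"] by (simp flip: power_add)

section \<open>Cancellative extensions of the preorder\<close>

definition extension :: "('a \<times> 'a) set \<Rightarrow> bool" where
  "extension r \<longleftrightarrow> preordered_semiring (\<lambda>z w. (z, w) \<in> r) \<and>
     (\<forall>c z w. c \<noteq> 0 \<longrightarrow> (c * z, c * w) \<in> r \<longrightarrow> (z, w) \<in> r) \<and> (\<forall>z w. z \<preceq> w \<longrightarrow> (z, w) \<in> r)"

lemma
  assumes "extension r"
  shows extension_trans: "(z, w) \<in> r \<Longrightarrow> (w, v) \<in> r \<Longrightarrow> (z, v) \<in> r"
    and extension_add: "(z, w) \<in> r \<Longrightarrow> (c + z, c + w) \<in> r"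
    and extension_mult: "(z, w) \<in> r \<Longrightarrow> (c * z, c * w) \<in> r"
    and extension_cancel: "c \<noteq> 0 \<Longrightarrow> (c * z, c * w) \<in> r \<Longrightarrow> (z, w) \<in> r"
    and extension_le: "z \<preceq> w \<Longrightarrow> (z, w) \<in> r"
    and extension_refl: "(z, z) \<in> r"
  using assms unfolding extension_def preordered_semiring_def by blast+

lemma extension_add2:
  "extension r \<Longrightarrow> (a, b) \<in> r \<Longrightarrow> (c, d) \<in> r \<Longrightarrow> (a + c, b + d) \<in> r"
  by (metis add.commute extension_add extension_trans)

lemma extension_mult2:
  "extension r \<Longrightarrow> (a, b) \<in> r \<Longrightarrow> (c, d) \<in> r \<Longrightarrow> (a * c, b * d) \<in> r"
  by (metis mult.commute extension_mult extension_trans)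

lemma extension_power: "extension r \<Longrightarrow> (a, b) \<in> r \<Longrightarrow> (a ^ n, b ^ n) \<in> r"
  by (induction n) (auto simp: extension_mult2 extension_refl)

lemma extension_Inter:
  assumes "\<And>r. r \<in> C \<Longrightarrow> extension r"
  shows "extension (\<Inter>C)"
  unfolding extension_def preordered_semiring_def
proof (intro conjI allI impI)
  fix z w v c
  show "(z, z) \<in> \<Inter>C"
    using assms extension_refl by blast
  show "(z, v) \<in> \<Inter>C" if "(z, w) \<in> \<Inter>C" "(w, v) \<in> \<Inter>C"
    using that assms extension_trans by (meson InterD InterI)
  show "(c + z, c + w) \<in> \<Inter>C" "(c * z, c * w) \<in> \<Inter>C" if "(z, w) \<in> \<Inter>C"
    using that assms extension_add extension_mult by blast+
  show "(z, w) \<in> \<Inter>C" if "c \<noteq> 0" "(c * z, c * w) \<in> \<Inter>C"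
    using that assms extension_cancel by (meson InterD InterI)
  show "(z, w) \<in> \<Inter>C" if "z \<preceq> w"
    using that assms extension_le by blast
qed

lemma extension_Union:
  assumes "C \<noteq> {}" and ext: "\<And>r. r \<in> C \<Longrightarrow> extension r"
    and dir: "\<And>r s. r \<in> C \<Longrightarrow> s \<in> C \<Longrightarrow> r \<subseteq> s \<or> s \<subseteq> r"
  shows "extension (\<Union>C)"
proof -
  obtain r0 where r0: "r0 \<in> C"
    using assms(1) by blast
  have tr: "(z, v) \<in> \<Union>C" if zw: "(z, w) \<in> \<Union>C" and wv: "(w, v) \<in> \<Union>C" for z w v
  proof -
    obtain r s where rs: "r \<in> C" "s \<in> C" "(z, w) \<in> r" "(w, v) \<in> s"
      using zw wv by blast
    with dir[of r s] consider "(w, v) \<in> r" | "(z, w) \<in> s"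
      by blast
    then show ?thesis
      using rs ext extension_trans by cases blast+
  qed
  show ?thesis
    unfolding extension_def preordered_semiring_def
  proof (intro conjI allI impI)
    fix z w c
    show "(z, z) \<in> \<Union>C"
      using r0 ext extension_refl by blast
    show "(c + z, c + w) \<in> \<Union>C" "(c * z, c * w) \<in> \<Union>C" if "(z, w) \<in> \<Union>C"
      using that ext extension_add extension_mult by blast+
    show "(z, w) \<in> \<Union>C" if "c \<noteq> 0" "(c * z, c * w) \<in> \<Union>C"
      using that ext extension_cancel by blast
    show "(z, w) \<in> \<Union>C" if "z \<preceq> w"
      using that r0 ext extension_le by blast
  qed (rule tr)
qed

text \<open>
  The least extension.
\<close>
definition cancellative_closure :: "('a \<times> 'a) set" where
  "cancellative_closure = {(z, w). \<exists>c. c \<noteq> 0 \<and> c * z \<preceq> c * w}"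

lemma extension_cancellative_closure: "extension cancellative_closure"
  unfolding extension_def preordered_semiring_def cancellative_closure_def mem_Collect_eq
    case_prod_conv
proof (intro conjI allI impI)
  fix z w v c
  show "\<exists>c. c \<noteq> 0 \<and> c * z \<preceq> c * z"
    using refl one_neq_zero by blast
  show "\<exists>c. c \<noteq> 0 \<and> c * z \<preceq> c * v"
    if zw: "\<exists>c. c \<noteq> 0 \<and> c * z \<preceq> c * w" and wv: "\<exists>c. c \<noteq> 0 \<and> c * w \<preceq> c * v"
  proof -
    obtain c d where cd: "c \<noteq> 0" "c * z \<preceq> c * w" "d \<noteq> 0" "d * w \<preceq> d * v"
      using zw wv by blast
    have "d * (c * z) \<preceq> d * (c * w)" "c * (d * w) \<preceq> c * (d * v)"
      by (intro mult_mono cd)+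
    then have "c * d * z \<preceq> c * d * v"
      using trans[of "d * (c * z)" "d * (c * w)" "c * (d * v)"] by (simp only: ac_simps)
    then show ?thesis
      using mult_nonzero cd by blast
  qed
  show "\<exists>d. d \<noteq> 0 \<and> d * (c + z) \<preceq> d * (c + w)" if "\<exists>c. c \<noteq> 0 \<and> c * z \<preceq> c * w"
    using that add_mono by (auto simp: distrib_left)
  show "\<exists>d. d \<noteq> 0 \<and> d * (c * z) \<preceq> d * (c * w)" if "\<exists>c. c \<noteq> 0 \<and> c * z \<preceq> c * w"
    using that mult_mono by (metis mult.left_commute)
  show "\<exists>c. c \<noteq> 0 \<and> c * z \<preceq> c * w" if "c \<noteq> 0" "\<exists>d. d \<noteq> 0 \<and> d * (c * z) \<preceq> d * (c * w)"
    using that mult_nonzero by (metis mult.assoc)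
  show "\<exists>c. c \<noteq> 0 \<and> c * z \<preceq> c * w" if "z \<preceq> w"
    using that by (intro exI[of _ 1]) simp
qed

section \<open>Adjoining an inequality\<close>

text \<open>
  The inequalities that follow from \<open>r\<close> together with \<open>a \<le> b\<close> without cancelling factors: a chain
  alternates between steps of \<open>r\<close> and replacements of a summand \<open>c * a\<close> by \<open>c * b\<close>.
\<close>
inductive exchange_chain :: "('a \<times> 'a) set \<Rightarrow> 'a \<Rightarrow> 'a \<Rightarrow> 'a \<Rightarrow> 'a \<Rightarrow> bool" for r a b where
  base: "(z, w) \<in> r \<Longrightarrow> exchange_chain r a b z w"
| step: "(z, t + c * a) \<in> r \<Longrightarrow> exchange_chain r a b (t + c * b) w \<Longrightarrow> exchange_chain r a b z w"

lemma exchange_chain_trans_base: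
  "exchange_chain r a b w v \<Longrightarrow> extension r \<Longrightarrow> (z, w) \<in> r \<Longrightarrow> exchange_chain r a b z v"
  by (induction rule: exchange_chain.induct) (auto intro: exchange_chain.intros extension_trans)

lemma exchange_chain_trans:
  "exchange_chain r a b z w \<Longrightarrow> extension r \<Longrightarrow> exchange_chain r a b w v \<Longrightarrow> exchange_chain r a b z v"
  by (induction rule: exchange_chain.induct) (auto intro: exchange_chain.step exchange_chain_trans_base)

lemma exchange_chain_add:
  "exchange_chain r a b z w \<Longrightarrow> extension r \<Longrightarrow> exchange_chain r a b (d + z) (d + w)"
proof (induction rule: exchange_chain.induct)
  case (base z w)
  then show ?case by (auto intro: exchange_chain.base extension_add)
next
  case (step z t c w)
  show ?case
    using extension_add[OF step.prems step.hyps(1), of d] step.IH[OF step.prems]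
    by - (rule exchange_chain.step[where t = "d + t" and c = c], simp_all add: add.assoc)
qed

lemma exchange_chain_mult:
  "exchange_chain r a b z w \<Longrightarrow> extension r \<Longrightarrow> exchange_chain r a b (d * z) (d * w)"
proof (induction rule: exchange_chain.induct)
  case (base z w)
  then show ?case by (auto intro: exchange_chain.base extension_mult)
next
  case (step z t c w)
  show ?case
    using extension_mult[OF step.prems step.hyps(1), of d] step.IH[OF step.prems]
    by - (rule exchange_chain.step[where t = "d * t" and c = "d * c"], simp_all add: distrib_left mult.assoc)
qed

lemma exchange_chain_single: "extension r \<Longrightarrow> exchange_chain r a b a b"
  by (rule exchange_chain.step[where t = 0 and c = 1]) (simp_all add: exchange_chain.base extension_refl)

definition adjoin :: "('a \<times> 'a) set \<Rightarrow> 'a \<Rightarrow> 'a \<Rightarrow> ('a \<times> 'a) set" where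
  "adjoin r a b = {(z, w). \<exists>k. k \<noteq> 0 \<and> exchange_chain r a b (k * z) (k * w)}"

lemma subset_adjoin: "r \<subseteq> adjoin r a b"
  unfolding adjoin_def by (auto intro!: exI[of _ 1] exchange_chain.base)

lemma adjoined: "extension r \<Longrightarrow> (a, b) \<in> adjoin r a b"
  unfolding adjoin_def by (auto intro!: exI[of _ 1] exchange_chain_single)

text \<open>
  For transitivity, chains for \<open>k * z, k * w\<close> and \<open>l * w, l * v\<close> are scaled to the common factor
  \<open>k * l\<close> and concatenated.
\<close>
lemma extension_adjoin:
  assumes r: "extension r"
  shows "extension (adjoin r a b)"
  unfolding extension_def preordered_semiring_def
proof (intro conjI allI impI)
  fix z w v c
  show "(z, z) \<in> adjoin r a b"
    using subset_adjoin extension_refl r by blast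
  show "(z, w) \<in> adjoin r a b" if "z \<preceq> w"
    using that subset_adjoin extension_le r by blast
  show "(z, v) \<in> adjoin r a b" if zw: "(z, w) \<in> adjoin r a b" and wv: "(w, v) \<in> adjoin r a b"
  proof -
    obtain k l where kl: "k \<noteq> 0" "exchange_chain r a b (k * z) (k * w)"
      "l \<noteq> 0" "exchange_chain r a b (l * w) (l * v)"
      using zw wv by (auto simp: adjoin_def)
    have "exchange_chain r a b (l * (k * z)) (l * (k * w))" "exchange_chain r a b (k * (l * w)) (k * (l * v))"
      by (intro exchange_chain_mult kl r)+
    then have "exchange_chain r a b (k * l * z) (k * l * v)"
      using exchange_chain_trans r by (simp add: ac_simps)
    then show ?thesis
      unfolding adjoin_def using kl mult_nonzero by blast
  qed
  show "(c + z, c + w) \<in> adjoin r a b" if "(z, w) \<in> adjoin r a b"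
    using that exchange_chain_add r by (auto simp: adjoin_def distrib_left)
  show "(c * z, c * w) \<in> adjoin r a b" if zw: "(z, w) \<in> adjoin r a b"
  proof -
    obtain k where "k \<noteq> 0" "exchange_chain r a b (k * z) (k * w)"
      using zw by (auto simp: adjoin_def)
    then show ?thesis
      using exchange_chain_mult[OF _ r, of a b "k * z" "k * w" c]
      by (auto simp: adjoin_def mult.left_commute)
  qed
  show "(z, w) \<in> adjoin r a b" if "c \<noteq> 0" "(c * z, c * w) \<in> adjoin r a b"
    using that mult_nonzero unfolding adjoin_def by (auto simp flip: mult.assoc)
qed

text \<open>
  The weight \<open>C\<close> is the sum of the coefficients \<open>c\<close> in the chain. In a ring the claim would say
  \<open>d * (z - w) \<le> C * d * (a - b)\<close>, which is \<open>d\<close> times the sum of the differences \<open>c * (a - b)\<close>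
  over all replacements. The summand \<open>s\<close>,
  on which \<open>C\<close> does not depend, is the slot in which a replacement of \<open>b\<close> by \<open>a\<close> takes place.
\<close>
lemma exchange_chain_weights:
  assumes "exchange_chain r a b z w" "extension r"
  shows "\<exists>C. \<forall>s d. (d * z + C * (s + d * b), d * w + C * (s + d * a)) \<in> r"
  using assms
proof (induction rule: exchange_chain.induct)
  case (base z w)
  then show ?case
    by (intro exI[of _ 0]) (auto intro: extension_mult)
next
  case (step z t c w)
  then obtain C where C: "\<And>s d. (d * (t + c * b) + C * (s + d * b), d * w + C * (s + d * a)) \<in> r"
    by blast
  show ?case
  proof (intro exI[of _ "c + C"] allI)
    fix s d
    let ?R = "\<lambda>z w. (z, w) \<in> r"
    have "?R (d * z + (c + C) * (s + d * b)) (d * (t + c * a) + (c + C) * (s + d * b))"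
      by (intro extension_add2 extension_mult extension_refl step)
    moreover have "d * (t + c * a) + (c + C) * (s + d * b)
        = c * (s + d * a) + (d * (t + c * b) + C * (s + d * b))"
      by (simp add: algebra_simps)
    moreover have "?R \<dots> (c * (s + d * a) + (d * w + C * (s + d * a)))"
      by (intro extension_add C step)
    moreover have "c * (s + d * a) + (d * w + C * (s + d * a)) = d * w + (c + C) * (s + d * a)"
      by (simp add: algebra_simps)
    ultimately show "?R (d * z + (c + C) * (s + d * b)) (d * w + (c + C) * (s + d * a))"
      using extension_trans step.prems by metis
  qed
qed

text \<open>
  Each replacement of \<open>b\<close> by \<open>a\<close> with coefficient \<open>d\<close> in the chain from \<open>y\<close> to \<open>y'\<close> is paid for by
  turning a copy of \<open>d * z\<close> into \<open>d * w\<close>, according to the preceding lemma. Here \<open>D\<close> collects the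
  coefficients.
\<close>
lemma exchange_chain_against:
  assumes "exchange_chain r b a y y'" "extension r"
    and C: "\<And>s d. (d * z + C * (s + d * b), d * w + C * (s + d * a)) \<in> r"
  shows "\<exists>D. (D * z + C * y, D * w + C * y') \<in> r"
  using assms(1,2)
proof (induction rule: exchange_chain.induct)
  case (base y y')
  then show ?case
    by (intro exI[of _ 0]) (auto intro: extension_mult)
next
  case (step y s d y')
  then obtain D where D: "(D * z + C * (s + d * a), D * w + C * y') \<in> r"
    by blast
  let ?R = "\<lambda>z w. (z, w) \<in> r"
  have "?R ((d + D) * z + C * y) ((d + D) * z + C * (s + d * b))"
    by (intro extension_add extension_mult step)
  moreover have "(d + D) * z + C * (s + d * b) = D * z + (d * z + C * (s + d * b))"
    by (simp add: algebra_simps)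
  moreover have "?R \<dots> (D * z + (d * w + C * (s + d * a)))"
    by (intro extension_add C step)
  moreover have "D * z + (d * w + C * (s + d * a)) = d * w + (D * z + C * (s + d * a))"
    by (simp add: algebra_simps)
  moreover have "?R \<dots> (d * w + (D * w + C * y'))"
    by (intro extension_add D step)
  moreover have "d * w + (D * w + C * y') = (d + D) * w + C * y'"
    by (simp add: algebra_simps)
  ultimately show ?case
    using extension_trans[OF step.prems] by metis
qed

text \<open>
  The two chains are played against each other with \<open>y = z\<close> and \<open>y' = w\<close>. The result is a common
  multiple of the desired inequality, without a common summand on both sides. This matters because
  only factors can be cancelled: in the tropical reals a large summand hides everything.
\<close>
lemma exchange_chain_both_directions:
  assumes "exchange_chain r a b z w" "exchange_chain r b a z w" "extension r"
  shows "(z, w) \<in> r"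
proof -
  obtain C where C: "\<And>s d. (d * z + C * (s + d * b), d * w + C * (s + d * a)) \<in> r"
    using exchange_chain_weights assms by blast
  show ?thesis
  proof (cases "C = 0")
    case True
    then show ?thesis
      using C[of 1 0] by simp
  next
    case False
    obtain D where "(D * z + C * z, D * w + C * w) \<in> r"
      using exchange_chain_against[OF assms(2,3) C] by blast
    then have "((D + C) * z, (D + C) * w) \<in> r"
      by (simp add: distrib_right)
    then show ?thesis
      using extension_cancel[OF assms(3)] sum_nonzero[OF False] by blast
  qed
qed

lemma adjoin_both_directions:
  assumes "(z, w) \<in> adjoin r a b" "(z, w) \<in> adjoin r b a" and r: "extension r"
  shows "(z, w) \<in> r"
proof -
  obtain k l where kl: "k \<noteq> 0" "exchange_chain r a b (k * z) (k * w)"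
    "l \<noteq> 0" "exchange_chain r b a (l * z) (l * w)"
    using assms by (auto simp: adjoin_def)
  have "exchange_chain r a b (l * (k * z)) (l * (k * w))" "exchange_chain r b a (k * (l * z)) (k * (l * w))"
    by (intro exchange_chain_mult kl r)+
  then have "(k * l * z, k * l * w) \<in> r"
    by (intro exchange_chain_both_directions r) (simp_all only: ac_simps)
  then show ?thesis
    using extension_cancel[OF r] mult_nonzero kl by blast
qed

text \<open>
  Zorn's lemma gives a maximal extension that avoids \<open>(x, y)\<close>. Adjoining any inequality that it lacks
  must produce \<open>(x, y)\<close>, so by the preceding lemma it cannot lack both \<open>(a, b)\<close> and \<open>(b, a)\<close>.
\<close>
lemma total_extension:
  assumes "extension r0" "(x, y) \<notin> r0"
  obtains r where "extension r" "r0 \<subseteq> r" "(x, y) \<notin> r" "\<And>a b. (a, b) \<in> r \<or> (b, a) \<in> r"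
proof -
  let ?E = "{r. extension r \<and> r0 \<subseteq> r \<and> (x, y) \<notin> r}"
  have "\<exists>M\<in>?E. \<forall>X\<in>?E. M \<subseteq> X \<longrightarrow> X = M"
  proof (rule subset_Zorn_nonempty)
    show "?E \<noteq> {}"
      using assms by blast
  next
    fix C
    assume "C \<noteq> {}" and chain: "subset.chain ?E C"
    then have sub: "C \<subseteq> ?E" and dir: "\<And>r s. r \<in> C \<Longrightarrow> s \<in> C \<Longrightarrow> r \<subseteq> s \<or> s \<subseteq> r"
      by (auto simp: subset_chain_def)
    have "extension (\<Union>C)"
      using \<open>C \<noteq> {}\<close> sub by (intro extension_Union dir) auto
    moreover have "r0 \<subseteq> \<Union>C" "(x, y) \<notin> \<Union>C"
      using \<open>C \<noteq> {}\<close> sub by auto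
    ultimately show "\<Union>C \<in> ?E"
      by simp
  qed
  then obtain r where "r \<in> ?E" and "\<forall>r'\<in>?E. r \<subseteq> r' \<longrightarrow> r' = r"
    by (rule bexE)
  then have r: "extension r" "r0 \<subseteq> r" "(x, y) \<notin> r"
    and max: "\<And>r'. extension r' \<Longrightarrow> r0 \<subseteq> r' \<Longrightarrow> (x, y) \<notin> r' \<Longrightarrow> r \<subseteq> r' \<Longrightarrow> r' = r"
    by simp_all
  have "(a, b) \<in> r \<or> (b, a) \<in> r" for a b
  proof (rule ccontr)
    assume "\<not> ?thesis"
    have "(x, y) \<in> adjoin r c d" if "(c, d) \<notin> r" for c d
      using that max[of "adjoin r c d"] r subset_adjoin[of r c d] adjoined[of r c d] extension_adjoin
      by auto
    with \<open>\<not> ?thesis\<close> have "(x, y) \<in> adjoin r a b" "(x, y) \<in> adjoin r b a"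
      by blast+
    then show False
      using adjoin_both_directions r by blast
  qed
  then show thesis
    using that r by blast
qed

section \<open>Homomorphisms from total extensions\<close>

lemma extension_not_one_le_zero:
  assumes "extension r" "(u, 1) \<notin> r"
  shows "(1, 0) \<notin> r"
  using extension_mult[OF assms(1), of 1 0 u] extension_le[OF assms(1) zero_le_one] assms
    extension_trans[OF assms(1), of u 0 1] by auto

text \<open>
  If \<open>u\<close> collapses to \<open>1\<close>, then so do all nonzero elements, as powers of \<open>u\<close> bound them. Avoiding one
  pair of nonzero elements thus excludes the homomorphism to the tropical reals that sends every
  nonzero element to \<open>1\<close>.
\<close>
lemma extension_u_nontrivial:
  assumes r: "extension r" and zw: "(z, w) \<notin> r" and w: "w \<noteq> 0"
  shows "(u, 1) \<notin> r"
proof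
  assume u: "(u, 1) \<in> r"
  obtain k l where k: "z \<preceq> u ^ k" and l: "1 \<preceq> w * u ^ l"
    using le_u_power one_le_mult_u_power w by blast
  have u_pow: "(u ^ n, 1) \<in> r" for n
    using extension_power[OF r u, of n] by simp
  have "(z, 1) \<in> r"
    using extension_trans[OF r extension_le[OF r k] u_pow] .
  moreover have "(1, w) \<in> r"
    using extension_trans[OF r extension_le[OF r l]] extension_mult[OF r u_pow[of l], of w] by simp
  ultimately show False
    using extension_trans[OF r] zw by blast
qed

lemma of_nat_nonzero: "n > 0 \<Longrightarrow> (of_nat n :: 'a) \<noteq> 0"
  using sum_nonzero[of 1 "of_nat (n - 1)"] by (cases n) (auto simp: add.commute)

text \<open>
  The height with respect to addition and the unit \<open>1\<close> is the supremum of the rationals below an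
  element.
\<close>
lemma archimedean_extension_hom:
  assumes r: "extension r" and total: "\<And>z w. (z, w) \<in> r \<or> (w, z) \<in> r"
    and u: "(u, 1) \<notin> r" and N: "(u, of_nat N) \<in> r"
  obtains \<phi> :: "'a \<Rightarrow> nnreal"
  where "semiring_hom \<phi>" "\<And>z w. (z, w) \<in> r \<Longrightarrow> \<phi> z \<le> \<phi> w"
proof -
  note trans = extension_trans[OF r]
  have two: "(1 + 1, 1) \<notin> r"
  proof
    assume two: "(1 + 1, 1) \<in> r"
    have "(of_nat n, 1) \<in> r" for n
    proof (induction n)
      case 0
      show ?case using extension_le[OF r zero_le_one] by simp
    next
      case (Suc n)
      then show ?case using trans[OF extension_add[OF r Suc] two] by simp
    qed
    then show False
      using trans N u by blast
  qed
  have of_nat_reflect: "m \<le> n" if mn: "(of_nat m, of_nat n) \<in> r" for m n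
  proof (rule ccontr)
    assume "\<not> m \<le> n"
    then have m: "m = Suc n + (m - Suc n)"
      by simp
    have "of_nat (Suc n) \<preceq> (of_nat m :: 'a)"
      by (subst m, subst of_nat_add) (metis le_add_left add.commute)
    then have suc: "(of_nat (Suc n), of_nat n) \<in> r"
      using trans[OF extension_le[OF r] mn] by blast
    \<comment> \<open>Once \<open>n + 1 \<le> n\<close>, every further \<open>1\<close> is absorbed too, so \<open>2 * n \<le> n\<close>, and cancelling \<open>n\<close>
      leaves \<open>2 \<le> 1\<close>.\<close>
    have absorb: "(of_nat (n + j), of_nat n) \<in> r" for j
    proof (induction j)
      case 0
      show ?case using extension_refl[OF r] by simp
    next
      case (Suc j)
      then show ?case using trans[OF extension_add[OF r Suc, of 1]] suc by simp
    qed
    have "n > 0"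
      using suc extension_not_one_le_zero[OF r u] by (cases n) auto
    moreover have "(of_nat n * (1 + 1), of_nat n * 1) \<in> r"
      using absorb[of n] by (simp add: mult_2_right)
    ultimately show False
      using extension_cancel[OF r of_nat_nonzero] two by blast
  qed
  interpret H: archimedean_preordered_monoid "(+)" "0 :: 'a" UNIV "\<lambda>n z. of_nat n * z"
    "\<lambda>z w. (z, w) \<in> r" 1
  proof unfold_locales
    fix z w v c :: 'a and m n :: nat
    show "(z, w) \<in> r \<or> (w, z) \<in> r"
      by (rule total)
    show "(z, w) \<in> r \<Longrightarrow> (w, v) \<in> r \<Longrightarrow> (z, v) \<in> r"
      by (rule trans)
    show "(z, w) \<in> r \<Longrightarrow> (c + z, c + w) \<in> r"
      by (rule extension_add[OF r])
    show "(0, 1) \<in> r"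
      using extension_le[OF r zero_le_one] .
    show "(of_nat m * 1, of_nat n * 1) \<in> r \<Longrightarrow> m \<le> n"
      using of_nat_reflect by simp
    obtain k where "z \<preceq> u ^ k"
      using le_u_power by blast
    then have "(z, of_nat N ^ k) \<in> r"
      using trans[OF extension_le[OF r]] extension_power[OF r N] by blast
    then show "\<exists>k. (z, of_nat k * 1) \<in> r"
      by (intro exI[of _ "N ^ k"]) simp
    show "\<exists>k. (0, z + of_nat k * 1) \<in> r"
      using extension_le[OF r zero_le] by blast
  qed (auto simp: distrib_right)
  let ?h = H.height
  have add: "?h (z + w) = ?h z + ?h w" for z w
    by (rule H.height_mul) auto
  have mono: "(z, w) \<in> r \<Longrightarrow> ?h z \<le> ?h w" for z w
    by (rule H.height_mono) auto
  have zero: "?h 0 = 0"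
    using add[of 0 0] by simp
  have nonneg: "?h z \<ge> 0" for z
    using mono[OF extension_le[OF r zero_le]] zero by simp
  have mult: "?h (z * w) = ?h z * ?h w" for z w
    using H.additive_mono_unique[of "\<lambda>z. ?h (w * z)" z] add mono extension_mult[OF r, of _ _ w]
    by (simp add: distrib_left mult.commute)
  have rep: "real_of_nnreal (Abs_nnreal (?h z)) = ?h z" for z
    by (simp add: Abs_nnreal_inverse nonneg)
  show thesis
  proof (rule that[of "\<lambda>z. Abs_nnreal (?h z)"])
    show "semiring_hom (\<lambda>z. Abs_nnreal (?h z))"
      unfolding semiring_hom_def real_of_nnreal_inject[symmetric] zero_nnreal.rep_eq
        one_nnreal.rep_eq plus_nnreal.rep_eq times_nnreal.rep_eq rep
      using add mult zero H.height_unit by simp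
    show "(z, w) \<in> r \<Longrightarrow> Abs_nnreal (?h z) \<le> Abs_nnreal (?h w)" for z w
      by (simp add: less_eq_nnreal.rep_eq rep mono)
  qed
qed

text \<open>
  The height with respect to multiplication and the unit \<open>u\<close> is the logarithm to base \<open>u\<close>. It turns
  sums into maxima because \<open>2\<^sup>n\<close> stays below \<open>u\<close> for all \<open>n\<close>, so that \<open>2\<close> has logarithm \<open>0\<close>, and
  \<open>w \<le> z + w \<le> 2 * w\<close> whenever \<open>z \<le> w\<close>.
\<close>
lemma nonarchimedean_extension_hom:
  assumes r: "extension r" and total: "\<And>z w. (z, w) \<in> r \<or> (w, z) \<in> r"
    and u: "(u, 1) \<notin> r" and N: "\<And>n. (of_nat n, u) \<in> r"
  obtains \<phi> :: "'a \<Rightarrow> tropical"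
  where "semiring_hom \<phi>" "\<And>z w. (z, w) \<in> r \<Longrightarrow> \<phi> z \<le> \<phi> w" "\<phi> u > 1"
proof -
  note trans = extension_trans[OF r]
  have u0: "u \<noteq> 0"
    using power_universal by (simp add: power_universal_def)
  interpret H: archimedean_preordered_monoid "(*)" "1 :: 'a" "{z. z \<noteq> 0}" "\<lambda>n z. z ^ n"
    "\<lambda>z w. (z, w) \<in> r" u
  proof unfold_locales
    fix z w v c :: 'a and m n :: nat
    show "(z, w) \<in> r \<or> (w, z) \<in> r"
      by (rule total)
    show "(z, w) \<in> r \<Longrightarrow> (w, v) \<in> r \<Longrightarrow> (z, v) \<in> r"
      by (rule trans)
    show "(z, w) \<in> r \<Longrightarrow> (c * z, c * w) \<in> r"
      by (rule extension_mult[OF r])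
    show "(1, u) \<in> r"
      using extension_le[OF r one_le_u] .
    show "m \<le> n" if mn: "(u ^ m, u ^ n) \<in> r"
    proof (rule ccontr)
      assume "\<not> m \<le> n"
      then have "u ^ m = u ^ n * u ^ (m - n)" and "1 \<le> m - n"
        by (simp_all flip: power_add)
      then have "(u ^ (m - n), 1) \<in> r"
        using mn extension_cancel[OF r power_nonzero[OF u0, of n], of "u ^ (m - n)" 1] by simp
      moreover have "(u, u ^ (m - n)) \<in> r"
        using extension_le[OF r u_power_mono[OF \<open>1 \<le> m - n\<close>]] by simp
      ultimately show False
        using trans u by blast
    qed
    show "\<exists>k. (z, u ^ k) \<in> r"
      using le_u_power extension_le[OF r] by blast
    show "\<exists>k. (1, z * u ^ k) \<in> r" if "z \<in> {z. z \<noteq> 0}"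
      using that one_le_mult_u_power extension_le[OF r] by blast
  qed (auto simp: u0 mult_nonzero)
  let ?h = H.height
  have mult: "?h (z * w) = ?h z + ?h w" if "z \<noteq> 0" "w \<noteq> 0" for z w
    using that by (intro H.height_mul) auto
  have mono: "?h z \<le> ?h w" if "(z, w) \<in> r" "z \<noteq> 0" "w \<noteq> 0" for z w
    using that by (intro H.height_mono) auto
  have one: "?h 1 = 0"
    using mult[of 1 1] by simp
  have h_u: "?h u = 1"
    by (rule H.height_unit)
  have two0: "(1 + 1 :: 'a) \<noteq> 0"
    by (rule sum_nonzero) simp
  have "real n * ?h (1 + 1) \<le> 1" for n
  proof -
    have "((1 + 1) ^ n, u) \<in> r"
      using N[of "2 ^ n"] by (simp add: one_add_one)
    then have "?h ((1 + 1) ^ n) \<le> 1"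
      using mono[of "(1 + 1) ^ n" u] power_nonzero[OF two0] u0 h_u by simp
    moreover have "?h ((1 + 1) ^ n) = real n * ?h (1 + 1)"
      using two0 mult by (intro H.additive_pow) auto
    ultimately show ?thesis
      by simp
  qed
  then have h_two: "?h (1 + 1) \<le> 0"
    by (meson not_le reals_Archimedean3)
  have sum: "?h (z + w) = ?h w" if zw: "(z, w) \<in> r" "z \<noteq> 0" "w \<noteq> 0" for z w
  proof (rule antisym)
    have "(z + w, (1 + 1) * w) \<in> r"
      using extension_add2[OF r zw(1) extension_refl[OF r, of w]] by (simp add: mult_2)
    then have "?h (z + w) \<le> ?h (1 + 1) + ?h w"
      using mono[of "z + w" "(1 + 1) * w"] mult[OF two0 zw(3)] sum_nonzero[OF zw(3)]
        mult_nonzero[OF two0 zw(3)] by simp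
    then show "?h (z + w) \<le> ?h w"
      using h_two by simp
    show "?h w \<le> ?h (z + w)"
      using mono[OF extension_le[OF r le_add_left[of w z]]] zw sum_nonzero by blast
  qed
  let ?f = "\<lambda>z. if z = 0 then 0 else 2 powr ?h z"
  have rep: "real_of_tropical (Abs_tropical (?f z)) = ?f z" for z
    by (simp add: Abs_tropical_inverse)
  have f_mono: "?f z \<le> ?f w" if zw: "(z, w) \<in> r" for z w
  proof (cases "z = 0")
    case False
    have "w \<noteq> 0"
    proof
      assume "w = 0"
      obtain k where "1 \<preceq> z * u ^ k"
        using one_le_mult_u_power False by blast
      moreover have "(z * u ^ k, 0) \<in> r"
        using extension_mult[OF r zw, of "u ^ k"] \<open>w = 0\<close> by (simp add: mult.commute)
      ultimately have "(1, 0) \<in> r"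
        using trans extension_le[OF r] by blast
      then show False
        using extension_not_one_le_zero[OF r u] by blast
    qed
    then show ?thesis
      using False mono[OF zw] by simp
  qed simp
  have f_add_ordered: "?f (z + w) = max (?f z) (?f w)" if zw: "(z, w) \<in> r" for z w
  proof (cases "z = 0 \<or> w = 0")
    case True
    then show ?thesis
      by (auto simp: max_def)
  next
    case False
    then show ?thesis
      using sum[OF zw] mono[OF zw] sum_nonzero[of w z] by (simp add: max_def)
  qed
  have f_add: "?f (z + w) = max (?f z) (?f w)" for z w
    using total[of z w] f_add_ordered[of z w] f_add_ordered[of w z]
    by (metis add.commute max.commute)
  have f_mult: "?f (z * w) = ?f z * ?f w" for z w
    using mult_nonzero[of z w] mult[of z w] by (simp add: powr_add)
  show thesis
  proof (rule that[of "\<lambda>z. Abs_tropical (?f z)"])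
    show "semiring_hom (\<lambda>z. Abs_tropical (?f z))"
      unfolding semiring_hom_def real_of_tropical_inject[symmetric] zero_tropical.rep_eq
        one_tropical.rep_eq plus_tropical.rep_eq times_tropical.rep_eq rep
      using f_add f_mult one by simp
    show "(z, w) \<in> r \<Longrightarrow> Abs_tropical (?f z) \<le> Abs_tropical (?f w)" for z w
      unfolding less_eq_tropical.rep_eq rep by (rule f_mono)
    show "1 < Abs_tropical (?f u)"
      unfolding less_tropical.rep_eq rep one_tropical.rep_eq by (simp add: u0 h_u)
  qed
qed

section \<open>The spectrum and the separation theorem\<close>

text \<open>
  Both kinds of homomorphism as real-valued functions. The growth arguments use only multiplicativity
  and monotonicity, which the two kinds share.
\<close>
definition spectrum :: "('a \<Rightarrow> real) set" where
  "spectrum =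
     {\<lambda>z. real_of_nnreal (\<phi> z) | \<phi>. monotone_semiring_hom (\<preceq>) \<phi>} \<union>
     {\<lambda>z. real_of_tropical (\<phi> z) | \<phi>. monotone_semiring_hom (\<preceq>) \<phi> \<and> \<phi> u > 1}"

lemma spectrum_all_le_iff:
  "(\<forall>\<psi>\<in>spectrum. \<psi> x \<le> \<psi> y) \<longleftrightarrow>
     (\<forall>\<phi> :: 'a \<Rightarrow> nnreal. monotone_semiring_hom (\<preceq>) \<phi> \<longrightarrow> \<phi> x \<le> \<phi> y) \<and>
     (\<forall>\<phi> :: 'a \<Rightarrow> tropical. monotone_semiring_hom (\<preceq>) \<phi> \<and> \<phi> u > 1 \<longrightarrow> \<phi> x \<le> \<phi> y)"
  unfolding spectrum_def by (auto simp: less_eq_nnreal.rep_eq less_eq_tropical.rep_eq)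

lemma spectrum_all_less_iff:
  "(\<forall>\<psi>\<in>spectrum. \<psi> x < \<psi> y) \<longleftrightarrow>
     (\<forall>\<phi> :: 'a \<Rightarrow> nnreal. monotone_semiring_hom (\<preceq>) \<phi> \<longrightarrow> \<phi> x < \<phi> y) \<and>
     (\<forall>\<phi> :: 'a \<Rightarrow> tropical. monotone_semiring_hom (\<preceq>) \<phi> \<and> \<phi> u > 1 \<longrightarrow> \<phi> x < \<phi> y)"
  unfolding spectrum_def ball_Un by (auto simp: less_nnreal.rep_eq less_tropical.rep_eq)

lemma
  assumes "\<psi> \<in> spectrum"
  shows spectrum_one: "\<psi> 1 = 1"
    and spectrum_mult: "\<psi> (z * w) = \<psi> z * \<psi> w"
    and spectrum_mono: "z \<preceq> w \<Longrightarrow> \<psi> z \<le> \<psi> w"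
    and spectrum_nonneg: "\<psi> z \<ge> 0"
  using assms real_of_nnreal real_of_tropical
  by (auto simp: spectrum_def monotone_semiring_hom_def semiring_hom_def monotone_def
      one_nnreal.rep_eq times_nnreal.rep_eq less_eq_nnreal.rep_eq
      one_tropical.rep_eq times_tropical.rep_eq less_eq_tropical.rep_eq)

lemma spectrum_power: "\<psi> \<in> spectrum \<Longrightarrow> \<psi> (z ^ n) = \<psi> z ^ n"
  by (induction n) (auto simp: spectrum_one spectrum_mult)

lemma spectrum_pos:
  assumes \<psi>: "\<psi> \<in> spectrum" and z: "z \<noteq> 0"
  shows "\<psi> z > 0"
proof -
  obtain k where "1 \<preceq> z * u ^ k"
    using one_le_mult_u_power z by blast
  then have "1 \<le> \<psi> z * \<psi> u ^ k"
    using spectrum_mono[OF \<psi>, of 1 "z * u ^ k"]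
    by (simp add: spectrum_one spectrum_mult spectrum_power \<psi>)
  then show ?thesis
    using spectrum_nonneg[OF \<psi>, of z] by (cases "\<psi> z = 0") auto
qed

text \<open>
  For homomorphisms to the nonnegative reals this holds because \<open>1 + 1\<close> is bounded by a power of \<open>u\<close>
  and is sent to \<open>2\<close>.
\<close>
lemma spectrum_u_gt_one:
  assumes \<psi>: "\<psi> \<in> spectrum"
  shows "\<psi> u > 1"
proof -
  consider \<phi> where "\<psi> = (\<lambda>z. real_of_nnreal (\<phi> z))" "monotone_semiring_hom (\<preceq>) \<phi>"
    | \<phi> where "\<psi> = (\<lambda>z. real_of_tropical (\<phi> z))" "\<phi> u > 1"
    using \<psi> unfolding spectrum_def by blast
  then show ?thesis
  proof cases
    case (1 \<phi>)
    then have "\<phi> (1 + 1) = \<phi> 1 + \<phi> 1"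
      unfolding monotone_semiring_hom_def semiring_hom_def by blast
    then have "\<psi> (1 + 1) = \<psi> 1 + \<psi> 1"
      using 1 plus_nnreal.rep_eq by metis
    moreover obtain k where "1 + 1 \<preceq> u ^ k"
      using le_u_power by blast
    ultimately have "2 \<le> \<psi> u ^ k"
      using spectrum_mono[OF \<psi>, of "1 + 1" "u ^ k"] spectrum_one[OF \<psi>] spectrum_power[OF \<psi>]
      by simp
    then show ?thesis
      using power_le_one[of "\<psi> u" k] spectrum_nonneg[OF \<psi>, of u] by linarith
  next
    case (2 \<phi>)
    then show ?thesis
      by (simp add: less_tropical.rep_eq one_tropical.rep_eq)
  qed
qed

lemma total_extension_spectrum:
  assumes r: "extension r" and total: "\<And>z w. (z, w) \<in> r \<or> (w, z) \<in> r" and u: "(u, 1) \<notin> r"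
  obtains \<psi> where "\<psi> \<in> spectrum" "\<And>z w. (z, w) \<in> r \<Longrightarrow> \<psi> z \<le> \<psi> w"
proof (cases "\<exists>n. (u, of_nat n) \<in> r")
  case True
  then obtain \<phi> :: "'a \<Rightarrow> nnreal"
    where \<phi>: "semiring_hom \<phi>" "\<And>z w. (z, w) \<in> r \<Longrightarrow> \<phi> z \<le> \<phi> w"
    using archimedean_extension_hom[OF r total u] by blast
  then have "monotone_semiring_hom (\<preceq>) \<phi>"
    unfolding monotone_semiring_hom_def monotone_def using extension_le[OF r] by blast
  then have "(\<lambda>z. real_of_nnreal (\<phi> z)) \<in> spectrum"
    unfolding spectrum_def by blast
  then show thesis
    using that \<phi>(2) unfolding less_eq_nnreal.rep_eq by blast
next
  case False
  then have "(of_nat n, u) \<in> r" for n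
    using total by blast
  then obtain \<phi> :: "'a \<Rightarrow> tropical"
    where \<phi>: "semiring_hom \<phi>" "\<And>z w. (z, w) \<in> r \<Longrightarrow> \<phi> z \<le> \<phi> w" "\<phi> u > 1"
    using nonarchimedean_extension_hom[OF r total u] by blast
  then have "monotone_semiring_hom (\<preceq>) \<phi>"
    unfolding monotone_semiring_hom_def monotone_def using extension_le[OF r] by blast
  then have "(\<lambda>z. real_of_tropical (\<phi> z)) \<in> spectrum"
    unfolding spectrum_def using \<phi>(3) by blast
  then show thesis
    using that \<phi>(2) unfolding less_eq_tropical.rep_eq by blast
qed

text \<open>
  If no catalyst \<open>c\<close> exists, then \<open>(x, y)\<close> can be avoided by a total extension, and the homomorphism
  that this extension induces has \<open>\<psi> y \<le> \<psi> x\<close>.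
\<close>
theorem strict_imp_catalytic:
  assumes "y \<noteq> 0" and strict: "\<forall>\<psi>\<in>spectrum. \<psi> x < \<psi> y"
  shows "\<exists>c. c \<noteq> 0 \<and> c * x \<preceq> c * y"
proof (rule ccontr)
  assume "\<not> ?thesis"
  then have "(x, y) \<notin> cancellative_closure"
    by (simp add: cancellative_closure_def)
  then obtain r where r: "extension r" "(x, y) \<notin> r"
    and total: "\<And>a b. (a, b) \<in> r \<or> (b, a) \<in> r"
    using total_extension[OF extension_cancellative_closure] by metis
  obtain \<psi> where "\<psi> \<in> spectrum" "\<And>z w. (z, w) \<in> r \<Longrightarrow> \<psi> z \<le> \<psi> w"
    using total_extension_spectrum[OF r(1) total extension_u_nontrivial[OF r \<open>y \<noteq> 0\<close>]] by metis
  then show False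
    using total[of x y] r(2) strict by (meson not_less)
qed

text \<open>
  A compactness argument. If the gap fails for all \<open>m\<close>, then each \<open>m\<close> has a total extension in which
  \<open>y\<^sup>m \<le> u * x\<^sup>m\<close>. These inequalities are then imposed for all \<open>m\<close> at once, which yields a single
  homomorphism with \<open>\<psi> y ^ m \<le> \<psi> u * \<psi> x ^ m\<close> for all \<open>m\<close>, that is, with \<open>\<psi> y \<le> \<psi> x\<close>.
\<close>
lemma strict_imp_uniform_gap:
  assumes y: "y \<noteq> 0" and strict: "\<forall>\<psi>\<in>spectrum. \<psi> x < \<psi> y"
  shows "\<exists>m c. m \<ge> (1::nat) \<and> c \<noteq> 0 \<and> c * (u * x ^ m) \<preceq> c * y ^ m"
proof (rule ccontr)
  assume no_gap_pair: "\<not> ?thesis"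
  have no_gap: "(u * x ^ m, y ^ m) \<notin> cancellative_closure" if "m \<ge> 1" for m
    using that no_gap_pair by (auto simp: cancellative_closure_def)
  \<comment> \<open>The extensions in \<open>T t\<close> form a decreasing sequence of sets, so their intersections increase and
    have an extension as their union. A total extension by itself cannot be used here, since those
    for different \<open>t\<close> need not be nested.\<close>
  define T where "T t = {r. extension r \<and> (u, 1) \<notin> r \<and>
    (\<forall>m. 1 \<le> m \<and> m \<le> t \<longrightarrow> (y ^ m, u * x ^ m) \<in> r)}" for t :: nat
  have T_nonempty: "T t \<noteq> {}" for t
  proof -
    \<comment> \<open>Negating the gap for the exponent \<open>fact t\<close> negates it for all divisors of \<open>fact t\<close>, and
      every \<open>m\<close> with \<open>1 \<le> m \<le> t\<close> is one.\<close>
    obtain r where r: "extension r" "(u * x ^ fact t, y ^ fact t) \<notin> r"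
      and total: "\<And>a b. (a, b) \<in> r \<or> (b, a) \<in> r"
      using total_extension[OF extension_cancellative_closure no_gap[OF fact_ge_1]] by metis
    have "(y ^ m, u * x ^ m) \<in> r" if m: "1 \<le> m" "m \<le> t" for m
    proof (rule ccontr)
      assume "(y ^ m, u * x ^ m) \<notin> r"
      then have "(u * x ^ m, y ^ m) \<in> r"
        using total by blast
      obtain s where s: "fact t = m * s"
        using dvd_fact[OF m] by (auto elim: dvdE)
      then have "s \<ge> 1"
        by (cases s) auto
      have "((u * x ^ m) ^ s, (y ^ m) ^ s) \<in> r"
        using extension_power[OF r(1) \<open>(u * x ^ m, y ^ m) \<in> r\<close>] .
      then have "(x ^ fact t * u ^ s, y ^ fact t) \<in> r"
        by (simp add: s power_mult_distrib power_mult mult.commute)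
      moreover have "(x ^ fact t * u, x ^ fact t * u ^ s) \<in> r"
        using extension_mult[OF r(1) extension_le[OF r(1) u_power_mono[OF \<open>s \<ge> 1\<close>]]] by simp
      ultimately show False
        using extension_trans[OF r(1)] r(2) by (simp add: mult.commute)
    qed
    moreover have "(u, 1) \<notin> r"
      using extension_u_nontrivial[OF r power_nonzero[OF y]] .
    ultimately have "r \<in> T t"
      using r by (simp add: T_def)
    then show ?thesis
      by blast
  qed
  have G: "extension (\<Inter>(T t))" for t
    by (rule extension_Inter) (simp add: T_def)
  have "T t \<subseteq> T s" if "s \<le> t" for s t
    using that unfolding T_def by auto
  then have G_mono: "\<Inter>(T s) \<subseteq> \<Inter>(T t)" if "s \<le> t" for s t
    using that by blast
  define U where "U = (\<Union>t. \<Inter>(T t))"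
  have "extension U"
    unfolding U_def
  proof (rule extension_Union)
    fix r s
    assume "r \<in> range (\<lambda>t. \<Inter>(T t))" "s \<in> range (\<lambda>t. \<Inter>(T t))"
    then obtain i j where "r = \<Inter>(T i)" "s = \<Inter>(T j)"
      by blast
    then show "r \<subseteq> s \<or> s \<subseteq> r"
      using G_mono nat_le_linear by metis
  qed (auto simp: G)
  moreover have "(u, 1) \<notin> U"
    using T_nonempty unfolding U_def T_def by blast
  ultimately obtain r where r: "extension r" "U \<subseteq> r" "(u, 1) \<notin> r"
    and total: "\<And>a b. (a, b) \<in> r \<or> (b, a) \<in> r"
    using total_extension by metis
  obtain \<psi> where \<psi>: "\<psi> \<in> spectrum" "\<And>z w. (z, w) \<in> r \<Longrightarrow> \<psi> z \<le> \<psi> w"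
    using total_extension_spectrum[OF r(1) total r(3)] by metis
  have "\<psi> y ^ m \<le> \<psi> u * \<psi> x ^ m" if "m \<ge> 1" for m
  proof -
    have "(y ^ m, u * x ^ m) \<in> r"
      using that r(2) unfolding U_def T_def by blast
    then show ?thesis
      using \<psi>(2)[of "y ^ m" "u * x ^ m"] by (simp add: spectrum_power spectrum_mult \<psi>(1))
  qed
  then have "\<psi> y \<le> \<psi> x"
    using le_if_powers_le spectrum_nonneg[OF \<psi>(1)] by blast
  then show False
    using strict \<psi>(1) by fastforce
qed

section \<open>Asymptotic inequalities\<close>

text \<open>
  The same \<open>c\<close> works for all powers, and powers of \<open>u\<close> bound it from both sides.
\<close>
lemma catalyst_removal:
  assumes c: "c \<noteq> 0" and le: "c * a \<preceq> c * b"
  obtains K where "\<And>i. a ^ i \<preceq> u ^ K * b ^ i"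
proof -
  have pow: "c * a ^ i \<preceq> c * b ^ i" for i
  proof (induction i)
    case 0
    show ?case by (simp add: refl)
  next
    case (Suc i)
    have "a * (c * a ^ i) \<preceq> a * (c * b ^ i)" "b ^ i * (c * a) \<preceq> b ^ i * (c * b)"
      by (intro mult_mono Suc le)+
    then show ?case
      using trans[of "a * (c * a ^ i)" "a * (c * b ^ i)" "b ^ i * (c * b)"] by (simp add: ac_simps)
  qed
  obtain k l where k: "c \<preceq> u ^ k" and l: "1 \<preceq> c * u ^ l"
    using le_u_power one_le_mult_u_power c by blast
  have "a ^ i \<preceq> u ^ (l + k) * b ^ i" for i
  proof -
    have "a ^ i \<preceq> u ^ l * (c * a ^ i)"
      using mult_mono[OF l, of "a ^ i"] by (simp add: ac_simps)
    moreover have "u ^ l * (c * a ^ i) \<preceq> u ^ l * (c * b ^ i)"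
      by (rule mult_mono[OF pow])
    moreover have "u ^ l * (c * b ^ i) \<preceq> u ^ (l + k) * b ^ i"
      using mult_mono[OF k, of "u ^ l * b ^ i"] by (simp add: ac_simps power_add)
    ultimately show ?thesis
      by (blast intro: trans)
  qed
  then show thesis
    by (rule that)
qed

lemma small_powers_ratio_bound:
  assumes "y \<noteq> 0"
  obtains q where "\<And>r. r < m \<Longrightarrow> x ^ r \<preceq> u ^ q * y ^ r"
proof -
  have "\<exists>q. \<forall>r<m. x ^ r \<preceq> u ^ q * y ^ r"
  proof (induction m)
    case 0
    show ?case by simp
  next
    case (Suc m)
    then obtain q where q: "\<And>r. r < m \<Longrightarrow> x ^ r \<preceq> u ^ q * y ^ r"
      by blast
    obtain k l where k: "x ^ m \<preceq> u ^ k" and l: "1 \<preceq> y ^ m * u ^ l"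
      using le_u_power one_le_mult_u_power power_nonzero[OF assms] by blast
    have m: "x ^ m \<preceq> u ^ (k + l) * y ^ m"
      using mult_mono2[OF k l] by (simp add: ac_simps power_add)
    have grow: "u ^ i * y ^ r \<preceq> u ^ j * y ^ r" if "i \<le> j" for i j r
      using mult_mono2[OF u_power_mono[OF that] refl] .
    have "x ^ r \<preceq> u ^ (q + (k + l)) * y ^ r" if "r < Suc m" for r
    proof (cases "r = m")
      case True
      then show ?thesis
        using trans[OF m grow] by simp
    next
      case False
      then have "r < m"
        using that by simp
      then show ?thesis
        using trans[OF q grow] by simp
    qed
    then show ?case
      by blast
  qed
  then show thesis
    using that by blast
qed

text \<open>
  The exponent is split as \<open>n = m * (n div m) + n mod m\<close>. The remaining powers, with exponent
  \<open>n mod m < m\<close>, cost only a constant power of \<open>u\<close>.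
\<close>
lemma catalytic_imp_eventually:
  assumes y: "y \<noteq> 0" and m: "m \<ge> (1::nat)" and c: "c \<noteq> 0"
    and le: "c * (u ^ p * x ^ m) \<preceq> c * (u ^ p' * y ^ m)"
  obtains K where "\<And>n. u ^ (p * (n div m)) * x ^ n \<preceq> u ^ (K + p' * (n div m)) * y ^ n"
proof -
  obtain K where K: "\<And>i. (u ^ p * x ^ m) ^ i \<preceq> u ^ K * (u ^ p' * y ^ m) ^ i"
    using catalyst_removal[OF c le] by blast
  obtain q where q: "\<And>r. r < m \<Longrightarrow> x ^ r \<preceq> u ^ q * y ^ r"
    using small_powers_ratio_bound[OF y] by blast
  have "u ^ (p * (n div m)) * x ^ n \<preceq> u ^ (K + q + p' * (n div m)) * y ^ n" for n
  proof -
    have split: "z ^ n = (z ^ m) ^ (n div m) * z ^ (n mod m)" for z :: 'a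
      by (simp flip: power_mult power_add)
    have "(u ^ p * x ^ m) ^ (n div m) * x ^ (n mod m)
        \<preceq> (u ^ K * (u ^ p' * y ^ m) ^ (n div m)) * (u ^ q * y ^ (n mod m))"
      using m by (intro mult_mono2 K q) simp
    then show ?thesis
      by (subst (1 2) split) (simp add: power_mult_distrib power_add ac_simps flip: power_mult)
  qed
  then show thesis
    by (rule that)
qed

text \<open>
  The gap contributes a factor \<open>u\<close> on the left for every \<open>m\<close> factors of \<open>x\<close>, hence eventually any
  given power \<open>u ^ p\<close>, while the cost \<open>K\<close> stays fixed.
\<close>
lemma strict_imp_eventually:
  assumes y: "y \<noteq> 0" and strict: "\<forall>\<psi>\<in>spectrum. \<psi> x < \<psi> y"
  obtains K where "\<And>p. \<forall>\<^sub>F n in sequentially. u ^ p * x ^ n \<preceq> u ^ K * y ^ n"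
proof -
  obtain m c where m: "m \<ge> (1::nat)" "c \<noteq> 0" "c * (u * x ^ m) \<preceq> c * y ^ m"
    using strict_imp_uniform_gap[OF y strict] by blast
  then obtain K where K: "\<And>n. u ^ (n div m) * x ^ n \<preceq> u ^ K * y ^ n"
    using catalytic_imp_eventually[OF y m(1,2), of 1 x 0] by auto
  have "\<forall>\<^sub>F n in sequentially. u ^ p * x ^ n \<preceq> u ^ K * y ^ n" for p
    using eventually_ge_at_top[of "p * m"]
  proof eventually_elim
    case (elim n)
    then have "p \<le> n div m"
      using m(1) by (simp add: less_eq_div_iff_mult_less_eq)
    then show ?case
      using trans[OF mult_mono2[OF u_power_mono refl] K] by blast
  qed
  then show thesis
    by (rule that)
qed

lemma asymptotic_imp_spectrum_le:
  assumes asym: "\<And>\<epsilon>::real. \<epsilon> > 0 \<Longrightarrow>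
      \<forall>\<^sub>F n in sequentially. x ^ n \<preceq> u ^ nat \<lfloor>\<epsilon> * real n\<rfloor> * y ^ n"
    and \<psi>: "\<psi> \<in> spectrum"
  shows "\<psi> x \<le> \<psi> y"
proof (rule le_if_powers_le)
  show "0 \<le> \<psi> y"
    by (rule spectrum_nonneg[OF \<psi>])
  fix m :: nat
  assume m: "m \<ge> 1"
  then have "\<forall>\<^sub>F n in sequentially. x ^ n \<preceq> u ^ nat \<lfloor>1 / real m * real n\<rfloor> * y ^ n"
    by (intro asym) simp
  then obtain N where N: "\<And>n. n \<ge> N \<Longrightarrow> x ^ n \<preceq> u ^ nat \<lfloor>1 / real m * real n\<rfloor> * y ^ n"
    by (auto simp: eventually_sequentially)
  define i where "i = Suc N"
  have "N \<le> m * i"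
    using m mult_le_mono[of 1 m N i] by (simp add: i_def)
  moreover have "nat \<lfloor>1 / real m * real (m * i)\<rfloor> = i"
    using m by simp
  ultimately have "x ^ (m * i) \<preceq> u ^ i * y ^ (m * i)"
    using N[of "m * i"] by simp
  then have "(\<psi> x ^ m) ^ i \<le> (\<psi> u * \<psi> y ^ m) ^ i"
    using spectrum_mono[OF \<psi>, of "x ^ (m * i)" "u ^ i * y ^ (m * i)"]
    by (simp add: spectrum_mult spectrum_power \<psi> power_mult power_mult_distrib)
  moreover have "i > 0" "0 \<le> \<psi> u * \<psi> y ^ m"
    using spectrum_nonneg[OF \<psi>] by (simp_all add: i_def)
  ultimately show "\<psi> x ^ m \<le> \<psi> u * \<psi> y ^ m"
    using spectrum_nonneg[OF \<psi>] by (simp add: power_mono_iff)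
qed

text \<open>
  With \<open>m > 2 / \<epsilon>\<close>, the exponent \<open>K + n div m\<close> of \<open>u\<close> consists of a constant and a part of at
  most \<open>\<epsilon> * n / 2\<close>, so it is eventually at most \<open>\<epsilon> * n\<close>.
\<close>
lemma spectrum_le_imp_asymptotic:
  fixes \<epsilon> :: real
  assumes y: "y \<noteq> 0" and le: "\<And>\<psi>. \<psi> \<in> spectrum \<Longrightarrow> \<psi> x \<le> \<psi> y" and \<epsilon>: "\<epsilon> > 0"
  shows "\<forall>\<^sub>F n in sequentially. x ^ n \<preceq> u ^ nat \<lfloor>\<epsilon> * real n\<rfloor> * y ^ n"
proof -
  obtain m :: nat where "2 / \<epsilon> < real m"
    using reals_Archimedean2 by blast
  then have "2 < \<epsilon> * real m"
    using \<epsilon> by (simp add: field_simps)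
  moreover from this have "m \<noteq> 0"
    by (intro notI) simp
  ultimately have m: "m \<ge> 1" "2 < \<epsilon> * real m"
    by simp_all
  have "\<psi> (x ^ m) < \<psi> (u * y ^ m)" if \<psi>: "\<psi> \<in> spectrum" for \<psi>
  proof -
    have "\<psi> x ^ m \<le> \<psi> y ^ m"
      by (intro power_mono le spectrum_nonneg \<psi>)
    also have "\<dots> < \<psi> u * \<psi> y ^ m"
      using spectrum_u_gt_one[OF \<psi>] spectrum_pos[OF \<psi> y] by simp
    finally show ?thesis
      by (simp add: spectrum_power spectrum_mult \<psi>)
  qed
  moreover have "u * y ^ m \<noteq> 0"
    using power_universal mult_nonzero power_nonzero[OF y] by (simp add: power_universal_def)
  ultimately obtain c where "c \<noteq> 0" "c * x ^ m \<preceq> c * (u * y ^ m)"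
    using strict_imp_catalytic by blast
  then obtain K where K: "\<And>n. x ^ n \<preceq> u ^ (K + n div m) * y ^ n"
    using catalytic_imp_eventually[OF y m(1), of c 0 x 1] by auto
  show ?thesis
    using eventually_ge_at_top[of "nat \<lceil>2 * real K / \<epsilon>\<rceil>"]
  proof eventually_elim
    case (elim n)
    then have "2 * real K / \<epsilon> \<le> real n"
      by linarith
    then have "2 * real K \<le> \<epsilon> * real n"
      using \<epsilon> by (simp add: field_simps)
    moreover have "2 * real (n div m) \<le> \<epsilon> * real n"
    proof -
      have "2 * real (n div m) \<le> \<epsilon> * real m * real (n div m)"
        using m(2) by (intro mult_right_mono) auto
      also have "\<dots> = \<epsilon> * real (m * (n div m))"
        by simp
      also have "\<dots> \<le> \<epsilon> * real n"
        using \<epsilon> by (intro mult_left_mono of_nat_mono) auto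
      finally show ?thesis .
    qed
    ultimately have "real (K + n div m) \<le> \<epsilon> * real n"
      by simp
    then have "K + n div m \<le> nat \<lfloor>\<epsilon> * real n\<rfloor>"
      by linarith
    then show ?case
      using trans[OF K mult_mono2[OF u_power_mono refl]] by blast
  qed
qed

text \<open>
  Multiplying the sum by \<open>x\<close> or by \<open>y\<close> gives the same mixed terms, and \<open>x ^ Suc n\<close> or \<open>y ^ Suc n\<close>
  respectively.
\<close>
lemma power_sum_telescoping:
  assumes "a * x ^ Suc n \<preceq> a * y ^ Suc n"
  shows "a * (\<Sum>j = 0..n. x ^ j * y ^ (n - j)) * x \<preceq> a * (\<Sum>j = 0..n. x ^ j * y ^ (n - j)) * y"
proof -
  let ?mid = "\<Sum>j<n. x ^ Suc j * y ^ (n - j)"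
  have "(\<Sum>j = 0..n. x ^ j * y ^ (n - j)) * x = (\<Sum>j<Suc n. x ^ Suc j * y ^ (n - j))"
    by (simp add: sum_distrib_right sum_distrib_left atLeast0AtMost lessThan_Suc_atMost ac_simps)
  also have "\<dots> = ?mid + x ^ Suc n"
    by simp
  finally have x: "(\<Sum>j = 0..n. x ^ j * y ^ (n - j)) * x = ?mid + x ^ Suc n" .
  have "(\<Sum>j = 0..n. x ^ j * y ^ (n - j)) * y = (\<Sum>j<Suc n. x ^ j * y ^ (Suc n - j))"
    by (simp add: sum_distrib_right sum_distrib_left atLeast0AtMost lessThan_Suc_atMost Suc_diff_le
        ac_simps)
  also have "\<dots> = ?mid + y ^ Suc n"
    by (subst sum.lessThan_Suc_shift) (simp add: add.commute)
  finally have y: "(\<Sum>j = 0..n. x ^ j * y ^ (n - j)) * y = ?mid + y ^ Suc n" .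
  show ?thesis
    unfolding mult.assoc x y distrib_left by (rule add_mono[OF assms])
qed

end

theorem theorem7p15:
  fixes le :: "'a::comm_semiring_1 \<Rightarrow> 'a \<Rightarrow> bool"  (infix "\<preceq>" 50)
    and u x y :: 'a
  assumes "preordered_semiring (\<preceq>)"
    and "0 \<preceq> 1"
    and "power_universal (\<preceq>) u"
    and "x \<noteq> 0" and "y \<noteq> 0"
  shows
    "(((\<forall>\<phi> :: 'a \<Rightarrow> nnreal. monotone_semiring_hom (\<preceq>) \<phi> \<longrightarrow> \<phi> x \<le> \<phi> y) \<and>
       (\<forall>\<phi> :: 'a \<Rightarrow> tropical. monotone_semiring_hom (\<preceq>) \<phi> \<and> \<phi> u > 1 \<longrightarrow> \<phi> x \<le> \<phi> y))
      \<longleftrightarrow>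
      (\<forall>\<epsilon>::real. \<epsilon> > 0 \<longrightarrow>
         (\<forall>\<^sub>F n in sequentially. x ^ n \<preceq> u ^ nat \<lfloor>\<epsilon> * real n\<rfloor> * y ^ n)))
     \<and>
     ((\<forall>\<phi> :: 'a \<Rightarrow> nnreal. monotone_semiring_hom (\<preceq>) \<phi> \<longrightarrow> \<phi> x < \<phi> y) \<and>
      (\<forall>\<phi> :: 'a \<Rightarrow> tropical. monotone_semiring_hom (\<preceq>) \<phi> \<and> \<phi> u > 1 \<longrightarrow> \<phi> x < \<phi> y)
      \<longrightarrow>
      (\<exists>k::nat. \<forall>\<^sub>F n in sequentially. u ^ k * x ^ n \<preceq> u ^ k * y ^ n) \<and>
      (power_universal (\<preceq>) y \<longrightarrow> (\<forall>\<^sub>F n in sequentially. x ^ n \<preceq> y ^ n)) \<and>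
      (\<exists>a. a \<noteq> 0 \<and> a * x \<preceq> a * y) \<and>
      (\<exists>k::nat. \<forall>\<^sub>F n in sequentially.
         let a = u ^ k * (\<Sum>j = 0..n. x ^ j * y ^ (n - j)) in a * x \<preceq> a * y))"
proof (cases "1 \<preceq> 0")
  case True
  interpret preordered_semiring "(\<preceq>)"
    by (rule assms(1))
  have all_le: "z \<preceq> w" for z w
    using mult_mono[OF True, of z] mult_mono[OF assms(2), of w] trans by auto
  have "\<not> monotone_semiring_hom (\<preceq>) \<phi>" for \<phi> :: "'a \<Rightarrow> nnreal"
  proof
    assume "monotone_semiring_hom (\<preceq>) \<phi>"
    then have "(1::nnreal) \<le> 0"
      using True unfolding monotone_semiring_hom_def semiring_hom_def monotone_def by metis
    then show False
      by (simp add: less_eq_nnreal.rep_eq one_nnreal.rep_eq zero_nnreal.rep_eq)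
  qed
  moreover have "\<not> monotone_semiring_hom (\<preceq>) \<phi>" for \<phi> :: "'a \<Rightarrow> tropical"
  proof
    assume "monotone_semiring_hom (\<preceq>) \<phi>"
    then have "(1::tropical) \<le> 0"
      using True unfolding monotone_semiring_hom_def semiring_hom_def monotone_def by metis
    then show False
      by (simp add: less_eq_tropical.rep_eq one_tropical.rep_eq zero_tropical.rep_eq)
  qed
  moreover have "(1::'a) \<noteq> 0"
    by simp
  ultimately show ?thesis
    using all_le by (auto simp: Let_def intro!: exI[of _ "1::'a"])
next
  case False
  interpret preordered_semiring "(\<preceq>)"
    by (rule assms(1))
  interpret bounded_preordered_semiring "(\<preceq>)" u
    using False assms by unfold_locales
  have iff: "(\<forall>\<psi>\<in>spectrum. \<psi> x \<le> \<psi> y) \<longleftrightarrow>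
    (\<forall>\<epsilon>::real. \<epsilon> > 0 \<longrightarrow>
         (\<forall>\<^sub>F n in sequentially. x ^ n \<preceq> u ^ nat \<lfloor>\<epsilon> * real n\<rfloor> * y ^ n))"
    using asymptotic_imp_spectrum_le spectrum_le_imp_asymptotic[OF assms(5)] by blast
  have "(\<exists>k::nat. \<forall>\<^sub>F n in sequentially. u ^ k * x ^ n \<preceq> u ^ k * y ^ n) \<and>
      (power_universal (\<preceq>) y \<longrightarrow> (\<forall>\<^sub>F n in sequentially. x ^ n \<preceq> y ^ n)) \<and>
      (\<exists>a. a \<noteq> 0 \<and> a * x \<preceq> a * y) \<and>
      (\<exists>k::nat. \<forall>\<^sub>F n in sequentially.
         let a = u ^ k * (\<Sum>j = 0..n. x ^ j * y ^ (n - j)) in a * x \<preceq> a * y)"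
    if strict: "\<forall>\<psi>\<in>spectrum. \<psi> x < \<psi> y"
  proof -
    obtain K where K: "\<And>p. \<forall>\<^sub>F n in sequentially. u ^ p * x ^ n \<preceq> u ^ K * y ^ n"
      using strict_imp_eventually[OF assms(5)] strict by blast
    have d: "\<forall>\<^sub>F n in sequentially. x ^ n \<preceq> y ^ n" if pu: "power_universal (\<preceq>) y"
    proof -
      have "u ^ K \<noteq> 0"
        using assms(3) power_nonzero by (simp add: power_universal_def)
      then obtain j where j: "u ^ K \<preceq> y ^ j"
        using pu one_le_u_power[of K] unfolding power_universal_def by (metis mult_1 one_neq_zero)
      \<comment> \<open>The factor \<open>u ^ K\<close> on the right is absorbed by \<open>y ^ j\<close>. The corresponding \<open>x ^ j\<close> on the left
        costs a constant power of \<open>u\<close>, which is available for free there.\<close>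
      obtain p where p: "x ^ j \<preceq> u ^ p"
        using le_u_power by blast
      have "\<forall>\<^sub>F n in sequentially. x ^ (n + j) \<preceq> y ^ (n + j)"
        using K[of p]
      proof eventually_elim
        case (elim n)
        have "x ^ n * x ^ j \<preceq> x ^ n * u ^ p" "y ^ n * u ^ K \<preceq> y ^ n * y ^ j"
          by (intro mult_mono p j)+
        then show ?case
          using trans[OF trans[of "x ^ n * x ^ j" "u ^ p * x ^ n" "u ^ K * y ^ n"]] elim
          by (simp add: power_add mult.commute)
      qed
      then show ?thesis
        using eventually_sequentially_seg[of "\<lambda>n. x ^ n \<preceq> y ^ n" j] by blast
    qed
    have "\<forall>\<^sub>F n in sequentially. u ^ K * x ^ Suc n \<preceq> u ^ K * y ^ Suc n"
      using K[of K] eventually_sequentially_Suc[of "\<lambda>n. u ^ K * x ^ n \<preceq> u ^ K * y ^ n"]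
      by (rule iffD2[rotated])
    then have "\<forall>\<^sub>F n in sequentially.
         let a = u ^ K * (\<Sum>j = 0..n. x ^ j * y ^ (n - j)) in a * x \<preceq> a * y"
      unfolding Let_def by (rule eventually_mono) (rule power_sum_telescoping)
    moreover have "\<exists>a. a \<noteq> 0 \<and> a * x \<preceq> a * y"
      using strict_imp_catalytic[OF assms(5)] strict by blast
    ultimately show ?thesis
      using K[of K] d by blast
  qed
  then show ?thesis
    unfolding spectrum_all_le_iff[symmetric] spectrum_all_less_iff[symmetric] using iff by blast
qed

end
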